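(* Let $(d_1,\partial_1)$ and $(d_2,\partial_2)$ be coherent derivations on an ASI bialgebra $(A,\circ,\Delta)$. Suppose that $d_1,d_2$ commute and that $\partial_1,\partial_2$ commute. Let $(A_h,\circ_h)$ be the associative deformation induced by $(A,\circ,d_1,d_2)$ and $(A_h,\Delta_h)$ be the coassociative deformation induced by $(A,\Delta,\partial_1,\partial_2)$. Suppose that $$d_1(x)\circ d_2(y)=\partial_2(x\circ d_1(y)),\qquad d_1(x)\circ d_2(y)=\partial_1(d_2(x)\circ y),\qquad \forall x,y\in A,$$ $$(\partial_1\otimes\partial_2)\Delta=(\mathrm{id}_A\otimes\partial_1)\Delta d_2,\qquad (\partial_1\otimes\partial_2)\Delta=(\partial_2\otimes\mathrm{id}_A)\Delta d_1 .$$ Then $(A_h,\circ_h,\Delta_h)$ is an ASI bialgebra deformation of $(A,\circ,\Delta)$.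
   Context: Conventions. $\mathbf{k}$ is a field of characteristic $0$ and $\mathbf{K}=\mathbf{k}[[h]]$. Vector spaces, algebras and tensor products are over $\mathbf{k}$; algebras need not be unital, coalgebras need not be counital. For a vector space $V$, $V_h:=V[[h]]$; $V\subset V_h$ as constant series; $\equiv\pmod{h}$ means equality modulo $hV_h$. A topologically free $\mathbf{K}$-module is one isomorphic to some $V[[h]]$. $\hat\otimes$ is the $h$-adic completion of $\otimes_{\mathbf{K}}$, so $V_h\hat\otimes W_h\cong(V\otimes W)[[h]]$. $\sigma(x\otimes y)=y\otimes x$ and $\sigma_{\mathbf{K}}(x_h\hat\otimes y_h)=y_h\hat\otimes x_h$. $L_\circ(x)y=x\circ y$, $R_\circ(x)y=y\circ x$ (likewise for $\circ_h$). Coassociative coalgebra $(A,\Delta)$: $(\Delta\otimes\mathrm{id})\Delta=(\mathrm{id}\otimes\Delta)\Delta$. ASI (antisymmetric infinitesimal) bialgebra $(A,\circ,\Delta)$: $(A,\circ)$ is an associative algebra, $(A,\Delta)$ a coassociative coalgebra, and for all $x,y\in A$: $\Delta(x\circ y)=(\mathrm{id}\otimes L_\circ(x))\Delta(y)+(R_\circ(y)\otimes\mathrm{id})\Delta(x)$ and $(L_\circ(y)\otimes\mathrm{id}-\mathrm{id}\otimes R_\circ(y))\Delta(x)+\sigma\big((L_\circ(x)\otimes\mathrm{id}-\mathrm{id}\otimes R_\circ(x))\Delta(y)\big)=0$. Topologically free associative algebra: a topologically free $\mathbf{K}$-module with an associative $\mathbf{K}$-bilinear operation. Topologically free coassociative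 coalgebra $(A_h,\Delta_h)$: $\Delta_h:A_h\to A_h\hat\otimes A_h$ is $\mathbf{K}$-linear with $(\Delta_h\hat\otimes\mathrm{id})\Delta_h=(\mathrm{id}\hat\otimes\Delta_h)\Delta_h$. Topologically free ASI bialgebra $(A_h,\circ_h,\Delta_h)$: both of these with, for all $x_h,y_h\in A_h$, $\Delta_h(x_h\circ_h y_h)=(\mathrm{id}\hat\otimes L_{\circ_h}(x_h))\Delta_h(y_h)+(R_{\circ_h}(y_h)\hat\otimes\mathrm{id})\Delta_h(x_h)$ and $(L_{\circ_h}(y_h)\hat\otimes\mathrm{id}-\mathrm{id}\hat\otimes R_{\circ_h}(y_h))\Delta_h(x_h)+\sigma_{\mathbf{K}}\big((L_{\circ_h}(x_h)\hat\otimes\mathrm{id}-\mathrm{id}\hat\otimes R_{\circ_h}(x_h))\Delta_h(y_h)\big)=0$. ASI bialgebra deformation of $(A,\circ,\Delta)$: a topologically free ASI bialgebra $(A_h,\circ_h,\Delta_h)$ with $A_h=A[[h]]$, $x\circ_h y\equiv x\circ y\pmod h$ and $\Delta_h(x)\equiv\Delta(x)\pmod h$ for all $x,y\in A$. Coderivation on $(A,\Delta)$: a linear map $\partial:A\to A$ with $\Delta\partial=(\partial\otimes\mathrm{id}+\mathrm{id}\otimes\partial)\Delta$. Coherent derivation on an ASI bialgebra $(A,\circ,\Delta)$: a pair $(d,\partial)$, $d$ a derivation on $(A,\circ)$ and $\partial$ a coderivation on $(A,\Delta)$, such that for all $x,y\in A$: $\partial(x)\circ y=x\circ d(y)+\partial(x\circ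 y)$, $x\circ\partial(y)=d(x)\circ y+\partial(x\circ y)$, $(d\otimes\mathrm{id})\Delta=(\mathrm{id}\otimes\partial)\Delta+\Delta d$, $(\mathrm{id}\otimes d)\Delta=(\partial\otimes\mathrm{id})\Delta+\Delta d$. For commuting derivations $d_1,d_2$ of an associative algebra $(A,\circ)$, the associative deformation induced by $(A,\circ,d_1,d_2)$ is $(A_h,\circ_h)$ with $x\circ_h y=\sum_{s\ge0}\big(d_1^s(x)\circ d_2^s(y)\big)\frac{h^s}{s!}$ for $x,y\in A$, extended $\mathbf{K}$-bilinearly ($h$-adically continuously) to $A_h=A[[h]]$. For commuting coderivations $\partial_1,\partial_2$ of a coassociative coalgebra $(A,\Delta)$, the coassociative deformation induced by $(A,\Delta,\partial_1,\partial_2)$ is $(A_h,\Delta_h)$ with $\Delta_h(x)=\sum_{s\ge0}(\partial_1^s\otimes\partial_2^s)\Delta(x)\frac{h^s}{s!}$ for $x\in A$, extended $\mathbf{K}$-linearly to $A_h$. *)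

theory Defs
  imports
    "HOL-Computational_Algebra.Formal_Power_Series"
    "HOL-Library.Function_Algebras"
begin

section \<open>Bilinear and trilinear maps\<close>

text \<open>
  A vector space is a type of class \<^class>\<open>ab_group_add\<close> with a scalar multiplication satisfying
  \<^locale>\<open>vector_space\<close>. Multilinearity is stated for modules over a commutative ring, so that it
  applies both to vector spaces over the field and to modules over the power series ring.
\<close>

definition bilin ::
  "('r::comm_ring_1 \<Rightarrow> 'u::ab_group_add \<Rightarrow> 'u) \<Rightarrow> ('r \<Rightarrow> 'v::ab_group_add \<Rightarrow> 'v) \<Rightarrow>
   ('r \<Rightarrow> 'w::ab_group_add \<Rightarrow> 'w) \<Rightarrow> ('u \<Rightarrow> 'v \<Rightarrow> 'w) \<Rightarrow> bool" where
  "bilin sU sV sW f \<longleftrightarrow>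
     (\<forall>x. module_hom sV sW (\<lambda>y. f x y)) \<and> (\<forall>y. module_hom sU sW (\<lambda>x. f x y))"

definition trilin ::
  "('r::comm_ring_1 \<Rightarrow> 'u::ab_group_add \<Rightarrow> 'u) \<Rightarrow> ('r \<Rightarrow> 'v::ab_group_add \<Rightarrow> 'v) \<Rightarrow>
   ('r \<Rightarrow> 'w::ab_group_add \<Rightarrow> 'w) \<Rightarrow> ('r \<Rightarrow> 'x::ab_group_add \<Rightarrow> 'x) \<Rightarrow>
   ('u \<Rightarrow> 'v \<Rightarrow> 'w \<Rightarrow> 'x) \<Rightarrow> bool" where
  "trilin sU sV sW sX f \<longleftrightarrow>
     (\<forall>x y. module_hom sW sX (\<lambda>z. f x y z)) \<and> (\<forall>x z. module_hom sV sX (\<lambda>y. f x y z)) \<and>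
     (\<forall>y z. module_hom sU sX (\<lambda>x. f x y z))"


section \<open>Tensor products of vector spaces\<close>

text \<open>
  The tensor product of \<open>V\<close> and \<open>W\<close> is realised inside the dual of the space of bilinear forms on
  \<open>V \<times> W\<close>: the tensor \<open>x \<otimes> y\<close> is evaluation at \<open>(x, y)\<close>, and the tensor product is the span of
  these evaluations. Functionals take all functions \<open>V \<Rightarrow> W \<Rightarrow> k\<close> as arguments and are made to
  vanish on those that are not bilinear. Threefold tensors are treated in the same way with
  trilinear forms; this identifies \<open>(U \<otimes> V) \<otimes> W\<close> with \<open>U \<otimes> (V \<otimes> W)\<close>. The universal
  properties are \<open>tensor_universal\<close> and \<open>tensor3_universal\<close> below.
\<close>

type_synonym ('k, 'v, 'w) tens = "('v \<Rightarrow> 'w \<Rightarrow> 'k) \<Rightarrow> 'k"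
type_synonym ('k, 'u, 'v, 'w) tens3 = "('u \<Rightarrow> 'v \<Rightarrow> 'w \<Rightarrow> 'k) \<Rightarrow> 'k"

definition fun_scale :: "'k::times \<Rightarrow> ('b \<Rightarrow> 'k) \<Rightarrow> 'b \<Rightarrow> 'k" where
  "fun_scale c T = (\<lambda>\<beta>. c * T \<beta>)"

definition pure ::
  "('k::field \<Rightarrow> 'v::ab_group_add \<Rightarrow> 'v) \<Rightarrow> ('k \<Rightarrow> 'w::ab_group_add \<Rightarrow> 'w) \<Rightarrow>
   'v \<Rightarrow> 'w \<Rightarrow> ('k, 'v, 'w) tens" where
  "pure sV sW x y = (\<lambda>\<beta>. if bilin sV sW (*) \<beta> then \<beta> x y else 0)"

definition tensor ::
  "('k::field \<Rightarrow> 'v::ab_group_add \<Rightarrow> 'v) \<Rightarrow> ('k \<Rightarrow> 'w::ab_group_add \<Rightarrow> 'w) \<Rightarrow>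
   ('k, 'v, 'w) tens set" where
  "tensor sV sW = module.span fun_scale {pure sV sW x y | x y. True}"

definition pure3 ::
  "('k::field \<Rightarrow> 'u::ab_group_add \<Rightarrow> 'u) \<Rightarrow> ('k \<Rightarrow> 'v::ab_group_add \<Rightarrow> 'v) \<Rightarrow>
   ('k \<Rightarrow> 'w::ab_group_add \<Rightarrow> 'w) \<Rightarrow> 'u \<Rightarrow> 'v \<Rightarrow> 'w \<Rightarrow> ('k, 'u, 'v, 'w) tens3" where
  "pure3 sU sV sW x y z = (\<lambda>\<tau>. if trilin sU sV sW (*) \<tau> then \<tau> x y z else 0)"

definition tensor3 ::
  "('k::field \<Rightarrow> 'u::ab_group_add \<Rightarrow> 'u) \<Rightarrow> ('k \<Rightarrow> 'v::ab_group_add \<Rightarrow> 'v) \<Rightarrow>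
   ('k \<Rightarrow> 'w::ab_group_add \<Rightarrow> 'w) \<Rightarrow> ('k, 'u, 'v, 'w) tens3 set" where
  "tensor3 sU sV sW = module.span fun_scale {pure3 sU sV sW x y z | x y z. True}"

text \<open>
  The map \<open>f \<otimes> g\<close> for linear \<open>f\<close> and \<open>g\<close> is precomposition of bilinear forms with \<open>f \<times> g\<close>; the
  scalar multiplications are those of the codomains. See \<open>tensor_map_pure\<close>.
\<close>

definition tensor_map ::
  "('k::field \<Rightarrow> 'v'::ab_group_add \<Rightarrow> 'v') \<Rightarrow> ('k \<Rightarrow> 'w'::ab_group_add \<Rightarrow> 'w') \<Rightarrow>
   ('v \<Rightarrow> 'v') \<Rightarrow> ('w \<Rightarrow> 'w') \<Rightarrow> ('k, 'v, 'w) tens \<Rightarrow> ('k, 'v', 'w') tens" where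
  "tensor_map sV' sW' f g T =
     (\<lambda>\<beta>. if bilin sV' sW' (*) \<beta> then T (\<lambda>x y. \<beta> (f x) (g y)) else 0)"

definition tensor_flip :: "('k, 'v, 'w) tens \<Rightarrow> ('k, 'w, 'v) tens" where
  "tensor_flip T = (\<lambda>\<beta>. T (\<lambda>x y. \<beta> y x))"

text \<open>The maps \<open>D \<otimes> id\<close> and \<open>id \<otimes> D\<close> from \<open>A \<otimes> A\<close> to \<open>A \<otimes> A \<otimes> A\<close>, for linear \<open>D\<close> from \<open>A\<close> to
  \<open>A \<otimes> A\<close>; see \<open>tensor_left_pure\<close> and \<open>tensor_right_pure\<close>.\<close>

definition tensor_left ::
  "('k::field \<Rightarrow> 'a::ab_group_add \<Rightarrow> 'a) \<Rightarrow> ('a \<Rightarrow> ('k, 'a, 'a) tens) \<Rightarrow>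
   ('k, 'a, 'a) tens \<Rightarrow> ('k, 'a, 'a, 'a) tens3" where
  "tensor_left s D T =
     (\<lambda>\<tau>. if trilin s s s (*) \<tau> then T (\<lambda>x z. D x (\<lambda>u v. \<tau> u v z)) else 0)"

definition tensor_right ::
  "('k::field \<Rightarrow> 'a::ab_group_add \<Rightarrow> 'a) \<Rightarrow> ('a \<Rightarrow> ('k, 'a, 'a) tens) \<Rightarrow>
   ('k, 'a, 'a) tens \<Rightarrow> ('k, 'a, 'a, 'a) tens3" where
  "tensor_right s D T =
     (\<lambda>\<tau>. if trilin s s s (*) \<tau> then T (\<lambda>x z. D z (\<lambda>u v. \<tau> x u v)) else 0)"


section \<open>ASI bialgebras\<close>

definition assoc_algebra ::
  "('r::comm_ring_1 \<Rightarrow> 'a::ab_group_add \<Rightarrow> 'a) \<Rightarrow> ('a \<Rightarrow> 'a \<Rightarrow> 'a) \<Rightarrow> bool" where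
  "assoc_algebra s m \<longleftrightarrow>
     module s \<and> bilin s s s m \<and> (\<forall>x y z. m (m x y) z = m x (m y z))"

definition coassoc_coalgebra ::
  "('k::field \<Rightarrow> 'a::ab_group_add \<Rightarrow> 'a) \<Rightarrow> ('a \<Rightarrow> ('k, 'a, 'a) tens) \<Rightarrow> bool" where
  "coassoc_coalgebra s D \<longleftrightarrow>
     vector_space s \<and> Vector_Spaces.linear s fun_scale D \<and> (\<forall>x. D x \<in> tensor s s) \<and>
     (\<forall>x. tensor_left s D (D x) = tensor_right s D (D x))"

definition ASI_bialgebra ::
  "('k::field \<Rightarrow> 'a::ab_group_add \<Rightarrow> 'a) \<Rightarrow> ('a \<Rightarrow> 'a \<Rightarrow> 'a) \<Rightarrow>
   ('a \<Rightarrow> ('k, 'a, 'a) tens) \<Rightarrow> bool" where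
  "ASI_bialgebra s m D \<longleftrightarrow>
     assoc_algebra s m \<and> coassoc_coalgebra s D \<and>
     (let L = (\<lambda>x y. m x y); R = (\<lambda>x y. m y x); tm = tensor_map s s in
       (\<forall>x y. D (m x y) = tm id (L x) (D y) + tm (R y) id (D x)) \<and>
       (\<forall>x y. (tm (L y) id (D x) - tm id (R y) (D x)) +
              tensor_flip (tm (L x) id (D y) - tm id (R x) (D y)) = 0))"

definition derivation ::
  "('k::field \<Rightarrow> 'a::ab_group_add \<Rightarrow> 'a) \<Rightarrow> ('a \<Rightarrow> 'a \<Rightarrow> 'a) \<Rightarrow> ('a \<Rightarrow> 'a) \<Rightarrow> bool" where
  "derivation s m d \<longleftrightarrow>
     Vector_Spaces.linear s s d \<and> (\<forall>x y. d (m x y) = m (d x) y + m x (d y))"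

definition coderivation ::
  "('k::field \<Rightarrow> 'a::ab_group_add \<Rightarrow> 'a) \<Rightarrow> ('a \<Rightarrow> ('k, 'a, 'a) tens) \<Rightarrow> ('a \<Rightarrow> 'a) \<Rightarrow> bool" where
  "coderivation s D p \<longleftrightarrow>
     Vector_Spaces.linear s s p \<and>
     (\<forall>x. D (p x) = tensor_map s s p id (D x) + tensor_map s s id p (D x))"

definition coherent_derivation ::
  "('k::field \<Rightarrow> 'a::ab_group_add \<Rightarrow> 'a) \<Rightarrow> ('a \<Rightarrow> 'a \<Rightarrow> 'a) \<Rightarrow> ('a \<Rightarrow> ('k, 'a, 'a) tens) \<Rightarrow>
   ('a \<Rightarrow> 'a) \<Rightarrow> ('a \<Rightarrow> 'a) \<Rightarrow> bool" where
  "coherent_derivation s m D d p \<longleftrightarrow>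
     derivation s m d \<and> coderivation s D p \<and>
     (\<forall>x y. m (p x) y = m x (d y) + p (m x y)) \<and>
     (\<forall>x y. m x (p y) = m (d x) y + p (m x y)) \<and>
     (\<forall>x. tensor_map s s d id (D x) = tensor_map s s id p (D x) + D (d x)) \<and>
     (\<forall>x. tensor_map s s id d (D x) = tensor_map s s p id (D x) + D (d x))"


section \<open>Power series modules\<close>

text \<open>
  An element of \<open>V[[h]]\<close> is its sequence of coefficients, with pointwise addition; the ring
  \<open>k[[h]]\<close> is \<open>'k fps\<close>. The completed tensor product of \<open>V[[h]]\<close> and \<open>W[[h]]\<close> is
  \<open>(V \<otimes> W)[[h]]\<close>, i.e. the sequences in \<open>tensor sV sW\<close>.
\<close>

definition hscale :: "('k::comm_ring_1 \<Rightarrow> 'v::ab_group_add \<Rightarrow> 'v) \<Rightarrow>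
    'k fps \<Rightarrow> (nat \<Rightarrow> 'v) \<Rightarrow> nat \<Rightarrow> 'v" where
  "hscale s c X = (\<lambda>n. \<Sum>i\<le>n. s (fps_nth c i) (X (n - i)))"

definition hconst :: "'v::zero \<Rightarrow> nat \<Rightarrow> 'v" where
  "hconst x = (\<lambda>n. if n = 0 then x else 0)"

definition hseries :: "'v set \<Rightarrow> (nat \<Rightarrow> 'v) set" where
  "hseries S = {X. \<forall>n. X n \<in> S}"

text \<open>Congruence modulo \<open>h S[[h]]\<close>.\<close>

definition eq_mod_h :: "('k::comm_ring_1 \<Rightarrow> 'v::ab_group_add \<Rightarrow> 'v) \<Rightarrow> 'v set \<Rightarrow>
    (nat \<Rightarrow> 'v) \<Rightarrow> (nat \<Rightarrow> 'v) \<Rightarrow> bool" where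
  "eq_mod_h s S X Y \<longleftrightarrow> X - Y \<in> hscale s fps_X ` hseries S"

text \<open>
  The \<open>k[[h]]\<close>-linear, respectively \<open>k[[h]]\<close>-bilinear, \<open>h\<close>-adically continuous extensions of
  \<open>x \<mapsto> (\<Sum>r. F r x h^r)\<close> and \<open>(x, y) \<mapsto> (\<Sum>r. B r x y h^r)\<close>.
\<close>

definition hext :: "(nat \<Rightarrow> 'v \<Rightarrow> 'w::comm_monoid_add) \<Rightarrow> (nat \<Rightarrow> 'v) \<Rightarrow> nat \<Rightarrow> 'w" where
  "hext F X = (\<lambda>n. \<Sum>i\<le>n. F (n - i) (X i))"

definition hext2 :: "(nat \<Rightarrow> 'u \<Rightarrow> 'v \<Rightarrow> 'w::comm_monoid_add) \<Rightarrow>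
    (nat \<Rightarrow> 'u) \<Rightarrow> (nat \<Rightarrow> 'v) \<Rightarrow> nat \<Rightarrow> 'w" where
  "hext2 B X Y = (\<lambda>n. \<Sum>i\<le>n. \<Sum>j\<le>n - i. B (n - i - j) (X i) (Y j))"

text \<open>
  A \<open>k[[h]]\<close>-linear \<open>F\<close> on \<open>V[[h]]\<close> is the extension of its coefficient maps \<open>hcoeff F r\<close> on \<open>V\<close>
  (see \<open>hext_hcoeff\<close>), so the completed tensor product of two such maps is the extension of the
  Cauchy product of their coefficient maps (see \<open>htensor_map_pure\<close>).
\<close>

definition hcoeff :: "((nat \<Rightarrow> 'v::zero) \<Rightarrow> nat \<Rightarrow> 'w) \<Rightarrow> nat \<Rightarrow> 'v \<Rightarrow> 'w" where
  "hcoeff F r x = F (hconst x) r"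

definition hpure ::
  "('k::field \<Rightarrow> 'v::ab_group_add \<Rightarrow> 'v) \<Rightarrow> ('k \<Rightarrow> 'w::ab_group_add \<Rightarrow> 'w) \<Rightarrow>
   (nat \<Rightarrow> 'v) \<Rightarrow> (nat \<Rightarrow> 'w) \<Rightarrow> nat \<Rightarrow> ('k, 'v, 'w) tens" where
  "hpure sV sW X Y = (\<lambda>n. \<Sum>i\<le>n. pure sV sW (X i) (Y (n - i)))"

definition htensor_map ::
  "('k::field \<Rightarrow> 'v'::ab_group_add \<Rightarrow> 'v') \<Rightarrow> ('k \<Rightarrow> 'w'::ab_group_add \<Rightarrow> 'w') \<Rightarrow>
   ((nat \<Rightarrow> 'v::zero) \<Rightarrow> nat \<Rightarrow> 'v') \<Rightarrow> ((nat \<Rightarrow> 'w::zero) \<Rightarrow> nat \<Rightarrow> 'w') \<Rightarrow>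
   (nat \<Rightarrow> ('k, 'v, 'w) tens) \<Rightarrow> nat \<Rightarrow> ('k, 'v', 'w') tens" where
  "htensor_map sV' sW' F G =
     hext (\<lambda>r T. \<Sum>i\<le>r. tensor_map sV' sW' (hcoeff F i) (hcoeff G (r - i)) T)"

definition htensor_flip :: "(nat \<Rightarrow> ('k, 'v, 'w) tens) \<Rightarrow> nat \<Rightarrow> ('k, 'w, 'v) tens" where
  "htensor_flip T = (\<lambda>n. tensor_flip (T n))"

definition htensor_left ::
  "('k::field \<Rightarrow> 'a::ab_group_add \<Rightarrow> 'a) \<Rightarrow> ((nat \<Rightarrow> 'a) \<Rightarrow> nat \<Rightarrow> ('k, 'a, 'a) tens) \<Rightarrow>
   (nat \<Rightarrow> ('k, 'a, 'a) tens) \<Rightarrow> nat \<Rightarrow> ('k, 'a, 'a, 'a) tens3" where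
  "htensor_left s Dh = hext (\<lambda>r. tensor_left s (hcoeff Dh r))"

definition htensor_right ::
  "('k::field \<Rightarrow> 'a::ab_group_add \<Rightarrow> 'a) \<Rightarrow> ((nat \<Rightarrow> 'a) \<Rightarrow> nat \<Rightarrow> ('k, 'a, 'a) tens) \<Rightarrow>
   (nat \<Rightarrow> ('k, 'a, 'a) tens) \<Rightarrow> nat \<Rightarrow> ('k, 'a, 'a, 'a) tens3" where
  "htensor_right s Dh = hext (\<lambda>r. tensor_right s (hcoeff Dh r))"


section \<open>Topologically free ASI bialgebras and deformations\<close>

text \<open>
  Topologically free structures are taken on the module \<open>A[[h]]\<close> itself, which is the underlying
  module of a deformation of \<open>A\<close>.
\<close>

definition topfree_coassoc_coalgebra ::
  "('k::field \<Rightarrow> 'a::ab_group_add \<Rightarrow> 'a) \<Rightarrow> ((nat \<Rightarrow> 'a) \<Rightarrow> nat \<Rightarrow> ('k, 'a, 'a) tens) \<Rightarrow> bool" where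
  "topfree_coassoc_coalgebra s Dh \<longleftrightarrow>
     vector_space s \<and> module_hom (hscale s) (hscale fun_scale) Dh \<and>
     (\<forall>X. Dh X \<in> hseries (tensor s s)) \<and>
     (\<forall>X. htensor_left s Dh (Dh X) = htensor_right s Dh (Dh X))"

definition topfree_ASI_bialgebra ::
  "('k::field \<Rightarrow> 'a::ab_group_add \<Rightarrow> 'a) \<Rightarrow> ((nat \<Rightarrow> 'a) \<Rightarrow> (nat \<Rightarrow> 'a) \<Rightarrow> nat \<Rightarrow> 'a) \<Rightarrow>
   ((nat \<Rightarrow> 'a) \<Rightarrow> nat \<Rightarrow> ('k, 'a, 'a) tens) \<Rightarrow> bool" where
  "topfree_ASI_bialgebra s mh Dh \<longleftrightarrow>
     assoc_algebra (hscale s) mh \<and> topfree_coassoc_coalgebra s Dh \<and>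
     (let L = (\<lambda>X Y. mh X Y); R = (\<lambda>X Y. mh Y X); tm = htensor_map s s in
       (\<forall>X Y. Dh (mh X Y) = tm id (L X) (Dh Y) + tm (R Y) id (Dh X)) \<and>
       (\<forall>X Y. (tm (L Y) id (Dh X) - tm id (R Y) (Dh X)) +
              htensor_flip (tm (L X) id (Dh Y) - tm id (R X) (Dh Y)) = 0))"

definition ASI_bialgebra_deformation ::
  "('k::field \<Rightarrow> 'a::ab_group_add \<Rightarrow> 'a) \<Rightarrow> ('a \<Rightarrow> 'a \<Rightarrow> 'a) \<Rightarrow> ('a \<Rightarrow> ('k, 'a, 'a) tens) \<Rightarrow>
   ((nat \<Rightarrow> 'a) \<Rightarrow> (nat \<Rightarrow> 'a) \<Rightarrow> nat \<Rightarrow> 'a) \<Rightarrow>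
   ((nat \<Rightarrow> 'a) \<Rightarrow> nat \<Rightarrow> ('k, 'a, 'a) tens) \<Rightarrow> bool" where
  "ASI_bialgebra_deformation s m D mh Dh \<longleftrightarrow>
     topfree_ASI_bialgebra s mh Dh \<and>
     (\<forall>x y. eq_mod_h s UNIV (mh (hconst x) (hconst y)) (hconst (m x y))) \<and>
     (\<forall>x. eq_mod_h fun_scale (tensor s s) (Dh (hconst x)) (hconst (D x)))"

definition induced_mult ::
  "('k::field_char_0 \<Rightarrow> 'a::ab_group_add \<Rightarrow> 'a) \<Rightarrow> ('a \<Rightarrow> 'a \<Rightarrow> 'a) \<Rightarrow> ('a \<Rightarrow> 'a) \<Rightarrow> ('a \<Rightarrow> 'a) \<Rightarrow>
   (nat \<Rightarrow> 'a) \<Rightarrow> (nat \<Rightarrow> 'a) \<Rightarrow> nat \<Rightarrow> 'a" where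
  "induced_mult s m d1 d2 = hext2 (\<lambda>r x y. s (1 / fact r) (m ((d1 ^^ r) x) ((d2 ^^ r) y)))"

definition induced_comult ::
  "('k::field_char_0 \<Rightarrow> 'a::ab_group_add \<Rightarrow> 'a) \<Rightarrow> ('a \<Rightarrow> ('k, 'a, 'a) tens) \<Rightarrow>
   ('a \<Rightarrow> 'a) \<Rightarrow> ('a \<Rightarrow> 'a) \<Rightarrow> (nat \<Rightarrow> 'a) \<Rightarrow> nat \<Rightarrow> ('k, 'a, 'a) tens" where
  "induced_comult s D p1 p2 =
     hext (\<lambda>r x. fun_scale (1 / fact r) (tensor_map s s (p1 ^^ r) (p2 ^^ r) (D x)))"


section \<open>Characterising properties of the constructions\<close>

lemma vector_space_fun_scale: "vector_space (fun_scale :: 'k::field \<Rightarrow> ('b \<Rightarrow> 'k) \<Rightarrow> _)"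
  by unfold_locales (auto simp: fun_scale_def fun_eq_iff algebra_simps)

lemma vector_space_mult: "vector_space ((*) :: 'k::field \<Rightarrow> 'k \<Rightarrow> 'k)"
  by unfold_locales (auto simp: algebra_simps)

lemma bilin_iff_linear:
  fixes sU :: "'k::field \<Rightarrow> 'u::ab_group_add \<Rightarrow> 'u"
  shows "bilin sU sV sW f \<longleftrightarrow> (\<forall>x. Vector_Spaces.linear sV sW (\<lambda>y. f x y)) \<and>
     (\<forall>y. Vector_Spaces.linear sU sW (\<lambda>x. f x y))"
  by (simp add: bilin_def module_hom_iff_linear)

lemma sum_fun_apply: "sum F A x = (\<Sum>i\<in>A. F i x)"
  for F :: "'i \<Rightarrow> 'b \<Rightarrow> 'c::comm_monoid_add"
  by (induction A rule: infinite_finite_induct) auto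

lemma bilin_pure:
  assumes "vector_space sV" "vector_space sW"
  shows "bilin sV sW fun_scale (pure sV sW)"
proof -
  have "module_hom sW fun_scale (\<lambda>y. pure sV sW x y)" for x
    using assms vector_space_fun_scale
    by (auto simp: module_hom_def module_iff_vector_space module_hom_axioms_def pure_def
        fun_scale_def fun_eq_iff bilin_def)
  moreover have "module_hom sV fun_scale (\<lambda>x. pure sV sW x y)" for y
    using assms vector_space_fun_scale
    by (auto simp: module_hom_def module_iff_vector_space module_hom_axioms_def pure_def
        fun_scale_def fun_eq_iff bilin_def)
  ultimately show ?thesis by (simp add: bilin_def)
qed

lemma bilin_span_eq:
  assumes f: "bilin sU sV sW f" and g: "bilin sU sV sW g"
    and sp: "module.span sU B = UNIV" "module.span sV C = UNIV"
    and eq: "\<And>b c. b \<in> B \<Longrightarrow> c \<in> C \<Longrightarrow> f b c = g b c"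
  shows "f = g"
proof -
  have hom: "module_hom sV sW (f x)" "module_hom sV sW (g x)"
    "module_hom sU sW (\<lambda>x. f x y)" "module_hom sU sW (\<lambda>x. g x y)" for x y
    using f g by (auto simp: bilin_def)
  interpret UW: module_pair sU sW using hom(3) by (auto simp: module_hom_def module_pair_def)
  interpret VW: module_pair sV sW using hom(1) by (auto simp: module_hom_def module_pair_def)
  have 1: "f b y = g b y" if "b \<in> B" for b y
    using VW.module_hom_eq_on_span[OF hom(1,2), of C b b y] eq that sp by auto
  show ?thesis
    using UW.module_hom_eq_on_span[OF hom(3,4), of B] 1 sp by (auto simp: fun_eq_iff)
qed

lemma independent_dual_family:
  fixes S :: "('b \<Rightarrow> 'k::field) set"
  assumes dual: "\<And>v. v \<in> S \<Longrightarrow> \<exists>\<beta>. \<forall>w\<in>S. w \<beta> = (if w = v then 1 else 0)"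
  shows "\<not> module.dependent fun_scale S"
proof
  interpret vector_space "fun_scale :: 'k \<Rightarrow> ('b \<Rightarrow> 'k) \<Rightarrow> _" by (rule vector_space_fun_scale)
  assume "dependent S"
  then obtain t u v where t: "finite t" "t \<subseteq> S" "(\<Sum>w\<in>t. fun_scale (u w) w) = 0"
    and v: "v \<in> t" "u v \<noteq> 0"
    unfolding dependent_explicit by blast
  obtain \<beta> where \<beta>: "\<forall>w\<in>S. w \<beta> = (if w = v then 1 else 0)" using dual t v by blast
  have "(\<Sum>w\<in>t. fun_scale (u w) w) \<beta> = (\<Sum>w\<in>t. u w * w \<beta>)"
    by (simp add: sum_fun_apply fun_scale_def)
  also have "\<dots> = (\<Sum>w\<in>t. if w = v then u v else 0)"
  proof (rule sum.cong[OF refl])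
    fix w assume "w \<in> t"
    then have "w \<beta> = (if w = v then 1 else 0)" using \<beta> t(2) by blast
    then show "u w * w \<beta> = (if w = v then u v else 0)" by simp
  qed
  also have "\<dots> = u v" using t(1) v(1) by simp
  finally show False using t(3) v(2) by simp
qed

theorem tensor_universal:
  fixes sV :: "'k::field \<Rightarrow> 'v::ab_group_add \<Rightarrow> 'v"
    and sW :: "'k \<Rightarrow> 'w::ab_group_add \<Rightarrow> 'w"
  assumes V: "vector_space sV" and W: "vector_space sW" and f: "bilin sV sW sU f"
  shows "\<exists>\<phi>. Vector_Spaces.linear fun_scale sU \<phi> \<and> (\<forall>x y. \<phi> (pure sV sW x y) = f x y)"
    and "\<lbrakk>Vector_Spaces.linear fun_scale sU \<phi>; \<forall>x y. \<phi> (pure sV sW x y) = f x y;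
          Vector_Spaces.linear fun_scale sU \<psi>; \<forall>x y. \<psi> (pure sV sW x y) = f x y\<rbrakk>
         \<Longrightarrow> \<forall>T \<in> tensor sV sW. \<phi> T = \<psi> T"
proof -
  interpret V: vector_space sV by fact
  interpret W: vector_space sW by fact
  interpret U: vector_space sU
    using f by (auto simp: bilin_def module_hom_def module_iff_vector_space)
  interpret T: vector_space "fun_scale :: 'k \<Rightarrow> ('k, 'v, 'w) tens \<Rightarrow> _"
    by (rule vector_space_fun_scale)
  interpret TU: vector_space_pair "fun_scale :: 'k \<Rightarrow> ('k, 'v, 'w) tens \<Rightarrow> _" sU ..
  define B where "B = V.extend_basis {}"
  define C where "C = W.extend_basis {}"
  have B: "V.independent B" "V.span B = UNIV"
    unfolding B_def
    by (auto simp: V.independent_empty V.independent_extend_basis V.span_extend_basis)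
  have C: "W.independent C" "W.span C = UNIV"
    unfolding C_def
    by (auto simp: W.independent_empty W.independent_extend_basis W.span_extend_basis)
  define \<beta> where "\<beta> b c = (\<lambda>x y. V.representation B x b * W.representation C y c)" for b c
  have \<beta>: "bilin sV sW (*) (\<beta> b c)" for b c
    using V.linear_representation[OF B, of b] W.linear_representation[OF C, of c]
    unfolding bilin_def \<beta>_def linear_iff_module_hom
    by (auto simp: module_hom_def module_hom_axioms_def algebra_simps)
  let ?p = "\<lambda>z. pure sV sW (fst z) (snd z)"
  have ev: "?p z (\<beta> b c) = (if z = (b, c) then 1 else 0)"
    if "z \<in> B \<times> C" "b \<in> B" "c \<in> C" for z b c
  proof -
    have "?p z (\<beta> b c) = \<beta> b c (fst z) (snd z)"
      using \<beta> by (simp add: pure_def)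
    then show ?thesis
      using that by (auto simp: \<beta>_def V.representation_basis[OF B(1)]
          W.representation_basis[OF C(1)] prod_eq_iff)
  qed
  have inj: "inj_on ?p (B \<times> C)"
  proof (rule inj_onI)
    fix z z' assume z: "z \<in> B \<times> C" "z' \<in> B \<times> C" "?p z = ?p z'"
    obtain b c where bc: "z = (b, c)" "b \<in> B" "c \<in> C" using z(1) by blast
    have "(if z' = (b, c) then 1 else (0::'k)) = 1"
      unfolding ev[OF z(2) bc(2,3), symmetric] z(3)[symmetric]
      using ev[OF z(1) bc(2,3)] bc(1) by simp
    then show "z = z'" using bc(1) by (simp split: if_splits)
  qed
  have ind: "T.independent (?p ` (B \<times> C))"
  proof (rule independent_dual_family)
    fix v assume "v \<in> ?p ` (B \<times> C)"
    then obtain b c where v: "v = ?p (b, c)" "b \<in> B" "c \<in> C" by auto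
    have "w (\<beta> b c) = (if w = v then 1 else 0)" if w: "w \<in> ?p ` (B \<times> C)" for w
    proof -
      obtain z where z: "w = ?p z" "z \<in> B \<times> C" using w by (elim imageE)
      have "w = v \<longleftrightarrow> z = (b, c)"
        using inj_on_eq_iff[OF inj z(2), of "(b, c)"] z(1) v by simp
      then show ?thesis using ev[OF z(2) v(2,3)] z(1) by simp
    qed
    then show "\<exists>\<beta>. \<forall>w\<in>?p ` (B \<times> C). w \<beta> = (if w = v then 1 else 0)"
      by (intro exI[of _ "\<beta> b c"] ballI)
  qed
  define G where "G T = (\<lambda>(x, y). f x y) (inv_into (B \<times> C) ?p T)" for T
  have G: "G (pure sV sW b c) = f b c" if "b \<in> B" "c \<in> C" for b c
    using inv_into_f_f[OF inj, of "(b, c)"] that by (simp add: G_def)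
  obtain \<theta> where \<theta>: "Vector_Spaces.linear fun_scale sU \<theta>" "\<forall>T \<in> ?p ` (B \<times> C). \<theta> T = G T"
    using TU.linear_independent_extend[OF ind, of G] by (elim exE conjE)
  have comp: "module_hom t sU (\<lambda>x. \<theta> (g x))" if "module_hom t fun_scale g" for t g
    using module_hom_compose[OF that \<theta>(1)[folded module_hom_iff_linear]] by (simp add: o_def)
  have "bilin sV sW sU (\<lambda>x y. \<theta> (pure sV sW x y))"
    using bilin_pure[OF V W] unfolding bilin_def by (intro conjI allI comp) auto
  then have "(\<lambda>x y. \<theta> (pure sV sW x y)) = f"
  proof (rule bilin_span_eq[OF _ f B(2) C(2)])
    fix b c assume "b \<in> B" "c \<in> C"
    then show "\<theta> (pure sV sW b c) = f b c"
      using \<theta>(2) G by simp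
  qed
  with \<theta>(1) show "\<exists>\<theta>. Vector_Spaces.linear fun_scale sU \<theta> \<and> (\<forall>x y. \<theta> (pure sV sW x y) = f x y)"
    by (intro exI[of _ \<theta>]) (simp add: fun_eq_iff)
  show "\<forall>T \<in> tensor sV sW. \<phi> T = \<psi> T"
    if "Vector_Spaces.linear fun_scale sU \<phi>" "\<forall>x y. \<phi> (pure sV sW x y) = f x y"
      "Vector_Spaces.linear fun_scale sU \<psi>" "\<forall>x y. \<psi> (pure sV sW x y) = f x y"
    unfolding tensor_def by (intro ballI, erule TU.linear_eq_on[OF that(1,3)]) (use that(2,4) in auto)
qed

lemma trilin_pure3:
  assumes "vector_space sU" "vector_space sV" "vector_space sW"
  shows "trilin sU sV sW fun_scale (pure3 sU sV sW)"
proof -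
  have "module_hom sW fun_scale (\<lambda>z. pure3 sU sV sW x y z)" for x y
    using assms vector_space_fun_scale
    by (auto simp: module_hom_def module_iff_vector_space module_hom_axioms_def pure3_def
        fun_scale_def fun_eq_iff trilin_def)
  moreover have "module_hom sV fun_scale (\<lambda>y. pure3 sU sV sW x y z)" for x z
    using assms vector_space_fun_scale
    by (auto simp: module_hom_def module_iff_vector_space module_hom_axioms_def pure3_def
        fun_scale_def fun_eq_iff trilin_def)
  moreover have "module_hom sU fun_scale (\<lambda>x. pure3 sU sV sW x y z)" for y z
    using assms vector_space_fun_scale
    by (auto simp: module_hom_def module_iff_vector_space module_hom_axioms_def pure3_def
        fun_scale_def fun_eq_iff trilin_def)
  ultimately show ?thesis by (simp add: trilin_def)
qed

lemma trilin_span_eq: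
  assumes f: "trilin sU sV sW sX f" and g: "trilin sU sV sW sX g"
    and sp: "module.span sU A = UNIV" "module.span sV B = UNIV" "module.span sW C = UNIV"
    and eq: "\<And>a b c. a \<in> A \<Longrightarrow> b \<in> B \<Longrightarrow> c \<in> C \<Longrightarrow> f a b c = g a b c"
  shows "f = g"
proof -
  have 1: "f a = g a" if "a \<in> A" for a
    by (rule bilin_span_eq[of sV sW sX _ _ B C])
      (use f g sp eq that in \<open>auto simp: trilin_def bilin_def\<close>)
  have hom: "module_hom sU sX (\<lambda>x. f x y z)" "module_hom sU sX (\<lambda>x. g x y z)" for y z
    using f g by (auto simp: trilin_def)
  interpret UX: module_pair sU sX using hom(1) by (auto simp: module_hom_def module_pair_def)
  show ?thesis
    using UX.module_hom_eq_on_span[OF hom, of A] 1 sp by (auto simp: fun_eq_iff)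
qed

theorem tensor3_universal:
  fixes sU :: "'k::field \<Rightarrow> 'u::ab_group_add \<Rightarrow> 'u"
    and sV :: "'k \<Rightarrow> 'v::ab_group_add \<Rightarrow> 'v" and sW :: "'k \<Rightarrow> 'w::ab_group_add \<Rightarrow> 'w"
  assumes U: "vector_space sU" and V: "vector_space sV" and W: "vector_space sW"
    and f: "trilin sU sV sW sX f"
  shows "\<exists>\<phi>. Vector_Spaces.linear fun_scale sX \<phi> \<and> (\<forall>x y z. \<phi> (pure3 sU sV sW x y z) = f x y z)"
    and "\<lbrakk>Vector_Spaces.linear fun_scale sX \<phi>; \<forall>x y z. \<phi> (pure3 sU sV sW x y z) = f x y z;
          Vector_Spaces.linear fun_scale sX \<psi>; \<forall>x y z. \<psi> (pure3 sU sV sW x y z) = f x y z\<rbrakk>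
         \<Longrightarrow> \<forall>T \<in> tensor3 sU sV sW. \<phi> T = \<psi> T"
proof -
  interpret U: vector_space sU by fact
  interpret V: vector_space sV by fact
  interpret W: vector_space sW by fact
  interpret X: vector_space sX
    using f by (auto simp: trilin_def module_hom_def module_iff_vector_space)
  interpret T: vector_space "fun_scale :: 'k \<Rightarrow> ('k, 'u, 'v, 'w) tens3 \<Rightarrow> _"
    by (rule vector_space_fun_scale)
  interpret TX: vector_space_pair "fun_scale :: 'k \<Rightarrow> ('k, 'u, 'v, 'w) tens3 \<Rightarrow> _" sX ..
  define A where "A = U.extend_basis {}"
  define B where "B = V.extend_basis {}"
  define C where "C = W.extend_basis {}"
  have A: "U.independent A" "U.span A = UNIV"
    unfolding A_def
    by (auto simp: U.independent_empty U.independent_extend_basis U.span_extend_basis)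
  have B: "V.independent B" "V.span B = UNIV"
    unfolding B_def
    by (auto simp: V.independent_empty V.independent_extend_basis V.span_extend_basis)
  have C: "W.independent C" "W.span C = UNIV"
    unfolding C_def
    by (auto simp: W.independent_empty W.independent_extend_basis W.span_extend_basis)
  define \<tau> where "\<tau> a b c = (\<lambda>x y z. U.representation A x a * V.representation B y b *
    W.representation C z c)" for a b c
  have \<tau>: "trilin sU sV sW (*) (\<tau> a b c)" for a b c
    using U.linear_representation[OF A, of a] V.linear_representation[OF B, of b]
      W.linear_representation[OF C, of c]
    unfolding trilin_def \<tau>_def linear_iff_module_hom
    by (auto simp: module_hom_def module_hom_axioms_def algebra_simps)
  let ?p = "\<lambda>w. pure3 sU sV sW (fst w) (fst (snd w)) (snd (snd w))"
  have ev: "?p w (\<tau> a b c) = (if w = (a, b, c) then 1 else 0)"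
    if "w \<in> A \<times> B \<times> C" "a \<in> A" "b \<in> B" "c \<in> C" for w a b c
  proof -
    obtain x y z where w: "w = (x, y, z)" by (cases w)
    then have "?p w (\<tau> a b c) = \<tau> a b c x y z"
      using \<tau> by (simp add: pure3_def)
    then show ?thesis
      using that w by (auto simp: \<tau>_def U.representation_basis[OF A(1)]
          V.representation_basis[OF B(1)] W.representation_basis[OF C(1)])
  qed
  have inj: "inj_on ?p (A \<times> B \<times> C)"
  proof (rule inj_onI)
    fix w w' assume w: "w \<in> A \<times> B \<times> C" "w' \<in> A \<times> B \<times> C" "?p w = ?p w'"
    obtain a b c where abc: "w = (a, b, c)" "a \<in> A" "b \<in> B" "c \<in> C" using w(1) by blast
    have "(if w' = (a, b, c) then 1 else (0::'k)) = 1"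
      unfolding ev[OF w(2) abc(2-4), symmetric] w(3)[symmetric]
      using ev[OF w(1) abc(2-4)] abc(1) by simp
    then show "w = w'" using abc(1) by (simp split: if_splits)
  qed
  have ind: "T.independent (?p ` (A \<times> B \<times> C))"
  proof (rule independent_dual_family)
    fix v assume "v \<in> ?p ` (A \<times> B \<times> C)"
    then obtain a b c where v: "v = ?p (a, b, c)" "a \<in> A" "b \<in> B" "c \<in> C" by auto
    have "w (\<tau> a b c) = (if w = v then 1 else 0)" if w: "w \<in> ?p ` (A \<times> B \<times> C)" for w
    proof -
      obtain z where z: "w = ?p z" "z \<in> A \<times> B \<times> C" using w by (elim imageE)
      have "w = v \<longleftrightarrow> z = (a, b, c)"
        using inj_on_eq_iff[OF inj z(2), of "(a, b, c)"] z(1) v by simp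
      then show ?thesis using ev[OF z(2) v(2-4)] z(1) by simp
    qed
    then show "\<exists>\<beta>. \<forall>w\<in>?p ` (A \<times> B \<times> C). w \<beta> = (if w = v then 1 else 0)"
      by (intro exI[of _ "\<tau> a b c"] ballI)
  qed
  define G where "G T = (\<lambda>(x, y, z). f x y z) (inv_into (A \<times> B \<times> C) ?p T)" for T
  have G: "G (pure3 sU sV sW a b c) = f a b c" if "a \<in> A" "b \<in> B" "c \<in> C" for a b c
    using inv_into_f_f[OF inj, of "(a, b, c)"] that by (simp add: G_def)
  obtain \<theta> where \<theta>: "Vector_Spaces.linear fun_scale sX \<theta>" "\<forall>T \<in> ?p ` (A \<times> B \<times> C). \<theta> T = G T"
    using TX.linear_independent_extend[OF ind, of G] by (elim exE conjE)
  have comp: "module_hom t sX (\<lambda>x. \<theta> (g x))" if "module_hom t fun_scale g" for t g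
    using module_hom_compose[OF that \<theta>(1)[folded module_hom_iff_linear]] by (simp add: o_def)
  have "trilin sU sV sW sX (\<lambda>x y z. \<theta> (pure3 sU sV sW x y z))"
    using trilin_pure3[OF U V W] unfolding trilin_def by (intro conjI allI comp) auto
  then have "(\<lambda>x y z. \<theta> (pure3 sU sV sW x y z)) = f"
  proof (rule trilin_span_eq[OF _ f A(2) B(2) C(2)])
    fix a b c assume "a \<in> A" "b \<in> B" "c \<in> C"
    then show "\<theta> (pure3 sU sV sW a b c) = f a b c"
      using \<theta>(2) G by simp
  qed
  with \<theta>(1) show "\<exists>\<theta>. Vector_Spaces.linear fun_scale sX \<theta> \<and>
      (\<forall>x y z. \<theta> (pure3 sU sV sW x y z) = f x y z)"
    by (intro exI[of _ \<theta>]) (simp add: fun_eq_iff)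
  show "\<forall>T \<in> tensor3 sU sV sW. \<phi> T = \<psi> T"
    if "Vector_Spaces.linear fun_scale sX \<phi>" "\<forall>x y z. \<phi> (pure3 sU sV sW x y z) = f x y z"
      "Vector_Spaces.linear fun_scale sX \<psi>" "\<forall>x y z. \<psi> (pure3 sU sV sW x y z) = f x y z"
    unfolding tensor3_def by (intro ballI, erule TX.linear_eq_on[OF that(1,3)]) (use that(2,4) in auto)
qed

lemma bilin_comp:
  assumes "bilin sV' sW' sU \<beta>" "module_hom sV sV' f" "module_hom sW sW' g"
  shows "bilin sV sW sU (\<lambda>x y. \<beta> (f x) (g y))"
  using assms module_hom_compose[of sV sV' f sU] module_hom_compose[of sW sW' g sU]
  unfolding bilin_def by (fastforce simp: o_def)

lemma tensor_map_pure:
  assumes "Vector_Spaces.linear sV sV' f" "Vector_Spaces.linear sW sW' g"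
  shows "tensor_map sV' sW' f g (pure sV sW x y) = pure sV' sW' (f x) (g y)"
  by (auto simp: tensor_map_def pure_def fun_eq_iff
      bilin_comp[OF _ assms[folded module_hom_iff_linear]])

lemma tensor_flip_pure: "tensor_flip (pure sV sW x y) = pure sW sV y x"
  by (auto simp: tensor_flip_def pure_def bilin_def fun_eq_iff)

text \<open>Elements of the tensor product are linear functionals on the space of bilinear forms.\<close>

lemma tensor_linear:
  fixes sV :: "'k::field \<Rightarrow> 'v::ab_group_add \<Rightarrow> 'v"
  assumes T: "T \<in> tensor sV sW" and b: "bilin sV sW (*) \<beta>" "bilin sV sW (*) \<gamma>"
  shows "T (\<lambda>x y. \<beta> x y + \<gamma> x y) = T \<beta> + T \<gamma>" "T (\<lambda>x y. c * \<beta> x y) = c * T \<beta>"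
proof -
  interpret T: vector_space "fun_scale :: 'k \<Rightarrow> ('k, 'v, 'b) tens \<Rightarrow> _"
    by (rule vector_space_fun_scale)
  have b': "bilin sV sW (*) (\<lambda>x y. \<beta> x y + \<gamma> x y)" "bilin sV sW (*) (\<lambda>x y. c * \<beta> x y)"
    using b by (auto simp: bilin_def module_hom_def module_hom_axioms_def algebra_simps)
  have "T (\<lambda>x y. \<beta> x y + \<gamma> x y) = T \<beta> + T \<gamma> \<and> T (\<lambda>x y. c * \<beta> x y) = c * T \<beta>"
    using T unfolding tensor_def
    by (induction rule: T.span_induct_alt)
      (use b b' in \<open>auto simp: fun_scale_def pure_def algebra_simps\<close>)
  then show "T (\<lambda>x y. \<beta> x y + \<gamma> x y) = T \<beta> + T \<gamma>" "T (\<lambda>x y. c * \<beta> x y) = c * T \<beta>"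
    by auto
qed

lemma tensor_left_pure:
  assumes D: "Vector_Spaces.linear s fun_scale D" "\<And>x. D x \<in> tensor s s"
    and Dx: "D x = (\<Sum>i\<in>I. pure s s (u i) (v i))"
  shows "tensor_left s D (pure s s x z) = (\<Sum>i\<in>I. pure3 s s s (u i) (v i) z)"
proof
  fix \<tau>
  interpret D: Vector_Spaces.linear s fun_scale D by fact
  show "tensor_left s D (pure s s x z) \<tau> = (\<Sum>i\<in>I. pure3 s s s (u i) (v i) z) \<tau>"
  proof (cases "trilin s s s (*) \<tau>")
    case True
    have b: "bilin s s (*) (\<lambda>u v. \<tau> u v z)" for z
      using True by (simp add: trilin_def bilin_def)
    have add: "\<tau> u v (z + z') = \<tau> u v z + \<tau> u v z'" "\<tau> u v (s c z) = c * \<tau> u v z" for u v z z' c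
      using True module_hom.add[of s "(*)" "\<lambda>z. \<tau> u v z"]
        module_hom.scale[of s "(*)" "\<lambda>z. \<tau> u v z"]
      by (simp_all add: trilin_def)
    have "bilin s s (*) (\<lambda>x z. D x (\<lambda>u v. \<tau> u v z))"
      using tensor_linear[OF D(2) b b] vector_space_mult D.vs1.vector_space_axioms
      by (simp add: bilin_def module_hom_def module_hom_axioms_def module_iff_vector_space
          D.add D.scale fun_scale_def add)
    then show ?thesis using True b
      by (simp add: tensor_left_def sum_fun_apply pure3_def pure_def Dx)
  qed (simp add: tensor_left_def sum_fun_apply pure3_def)
qed

lemma tensor_right_pure:
  assumes D: "Vector_Spaces.linear s fun_scale D" "\<And>x. D x \<in> tensor s s"
    and Dz: "D z = (\<Sum>i\<in>I. pure s s (u i) (v i))"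
  shows "tensor_right s D (pure s s x z) = (\<Sum>i\<in>I. pure3 s s s x (u i) (v i))"
proof
  fix \<tau>
  interpret D: Vector_Spaces.linear s fun_scale D by fact
  show "tensor_right s D (pure s s x z) \<tau> = (\<Sum>i\<in>I. pure3 s s s x (u i) (v i)) \<tau>"
  proof (cases "trilin s s s (*) \<tau>")
    case True
    have b: "bilin s s (*) (\<lambda>u v. \<tau> x u v)" for x
      using True by (simp add: trilin_def bilin_def)
    have add: "\<tau> (x + x') u v = \<tau> x u v + \<tau> x' u v" "\<tau> (s c x) u v = c * \<tau> x u v" for u v x x' c
      using True module_hom.add[of s "(*)" "\<lambda>x. \<tau> x u v"]
        module_hom.scale[of s "(*)" "\<lambda>x. \<tau> x u v"]
      by (simp_all add: trilin_def)
    have add': "\<tau> (x + x') = (\<lambda>u v. \<tau> x u v + \<tau> x' u v)" "\<tau> (s c x) = (\<lambda>u v. c * \<tau> x u v)"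
      for x x' c
      by (simp_all add: add fun_eq_iff)
    have "bilin s s (*) (\<lambda>x z. D z (\<lambda>u v. \<tau> x u v))"
      using tensor_linear[OF D(2) b b] vector_space_mult D.vs1.vector_space_axioms
      by (simp add: bilin_def module_hom_def module_hom_axioms_def module_iff_vector_space
          D.add D.scale fun_scale_def add')
    then show ?thesis using True b
      by (simp add: tensor_right_def sum_fun_apply pure3_def pure_def Dz)
  qed (simp add: tensor_right_def sum_fun_apply pure3_def)
qed

lemma hscale_X_power:
  assumes "module s"
  shows "hscale s (fps_X ^ k) X n = (if n < k then 0 else X (n - k))"
proof -
  interpret module s by fact
  have "(\<Sum>i\<le>n. s (fps_nth (fps_X ^ k) i) (X (n - i))) = (\<Sum>i\<le>n. if i = k then X (n - k) else 0)"
    by (rule sum.cong) auto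
  then show ?thesis by (simp add: hscale_def)
qed

theorem hext_hcoeff:
  assumes F: "module_hom (hscale s) (hscale s') F" and s: "module s" "module s'"
  shows "F X = hext (hcoeff F) X"
proof
  fix n
  interpret F: module_hom "hscale s" "hscale s'" F by fact
  have "\<exists>Y. X = (\<Sum>i<k. hscale s (fps_X ^ i) (hconst (X i))) + hscale s (fps_X ^ k) Y" for k
  proof (intro exI ext)
    fix m
    have "(\<Sum>i<k. if m < i then 0 else hconst (X i) (m - i)) =
        (\<Sum>i<k. if i = m then X m else 0)"
      by (rule sum.cong) (auto simp: hconst_def)
    then show "X m = ((\<Sum>i<k. hscale s (fps_X ^ i) (hconst (X i))) +
        hscale s (fps_X ^ k) (\<lambda>j. X (j + k))) m"
      by (simp add: sum_fun_apply hscale_X_power[OF s(1)])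
  qed
  then obtain Y where Y:
    "X = (\<Sum>i<Suc n. hscale s (fps_X ^ i) (hconst (X i))) + hscale s (fps_X ^ Suc n) Y" by blast
  have "F X n = (\<Sum>i<Suc n. F (hconst (X i)) (n - i))"
    by (subst Y) (simp add: F.add F.sum F.scale sum_fun_apply hscale_X_power[OF s(2)]
        del: power_Suc sum.lessThan_Suc)
  then show "F X n = hext (hcoeff F) X n"
    by (simp add: hext_def hcoeff_def lessThan_Suc_atMost)
qed

lemma module_hom_hcoeff:
  assumes F: "module_hom (hscale s) (hscale s') F" and s: "module s" "module s'"
  shows "module_hom s s' (hcoeff F r)"
proof -
  interpret F: module_hom "hscale s" "hscale s'" F by fact
  interpret s: module s by fact
  interpret s': module s' by fact
  have add: "hconst (x + y) = hconst x + hconst y" for x y :: 'b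
    by (auto simp: hconst_def fun_eq_iff)
  have const: "(\<Sum>i\<le>n. t (fps_nth (fps_const c) i) (Z (n - i))) = t c (Z n)"
    if "module t" for t :: "'a \<Rightarrow> 'd::ab_group_add \<Rightarrow> 'd" and c Z n
  proof -
    interpret t: module t by fact
    have "(\<Sum>i\<le>n. t (fps_nth (fps_const c) i) (Z (n - i))) = (\<Sum>i\<le>n. if i = 0 then t c (Z n) else 0)"
      by (rule sum.cong) auto
    then show ?thesis by simp
  qed
  have scale: "hconst (s c x) = hscale s (fps_const c) (hconst x)" for c x
    by (intro ext, simp only: hscale_def const[OF s(1)]) (simp add: hconst_def)
  show ?thesis
    by unfold_locales (simp_all add: hcoeff_def add scale F.add F.scale,
        simp only: hscale_def const[OF s(2)])
qed

theorem htensor_map_pure: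
  assumes s: "vector_space sV" "vector_space sW" "vector_space sV'" "vector_space sW'"
    and F: "module_hom (hscale sV) (hscale sV') F" and G: "module_hom (hscale sW) (hscale sW') G"
  shows "htensor_map sV' sW' F G (hpure sV sW X Y) = hpure sV' sW' (F X) (G Y)"
proof
  fix n
  let ?f = "hcoeff F" and ?g = "hcoeff G" and ?P = "pure sV' sW'"
  note m = s[folded module_iff_vector_space]
  have bl: "bilin sV' sW' fun_scale ?P" by (rule bilin_pure[OF s(3,4)])
  have sl: "?P (\<Sum>i\<in>I. x i) y = (\<Sum>i\<in>I. ?P (x i) y)" for x y and I :: "nat set"
    using bl module_hom.sum[of sV' fun_scale "\<lambda>x. ?P x y"] by (simp add: bilin_def)
  have sr: "?P x (\<Sum>i\<in>I. y i) = (\<Sum>i\<in>I. ?P x (y i))" for x y and I :: "nat set"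
    using bl module_hom.sum[of sW' fun_scale "?P x"] by (simp add: bilin_def)
  have tm: "tensor_map sV' sW' (?f i) (?g j) (\<Sum>a\<in>I. pure sV sW (x a) (y a)) =
      (\<Sum>a\<in>I. ?P (?f i (x a)) (?g j (y a)))" for i j x y and I :: "nat set"
  proof -
    have "tensor_map sV' sW' p q (\<Sum>a\<in>I. T a) = (\<Sum>a\<in>I. tensor_map sV' sW' p q (T a))"
      for p q and T :: "nat \<Rightarrow> ('a, 'b, 'c) tens"
      by (auto simp: tensor_map_def sum_fun_apply fun_eq_iff)
    then show ?thesis
      using module_hom_hcoeff[OF F m(1,3), of i] module_hom_hcoeff[OF G m(2,4), of j]
      by (simp add: module_hom_iff_linear tensor_map_pure)
  qed
  have "htensor_map sV' sW' F G (hpure sV sW X Y) n =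
      (\<Sum>(l, i, a)\<in>(SIGMA l:{..n}. {..n - l} \<times> {..l}). ?P (?f i (X a)) (?g (n - l - i) (Y (l - a))))"
    by (simp add: htensor_map_def hext_def hpure_def tm sum.Sigma sum.cartesian_product)
  also have "\<dots> = (\<Sum>(c, b, a)\<in>(SIGMA c:{..n}. {..n - c} \<times> {..c}).
      ?P (?f (c - a) (X a)) (?g (n - c - b) (Y b)))"
    by (rule sum.reindex_bij_witness[where i = "\<lambda>(c, b, a). (a + b, c - a, a)"
          and j = "\<lambda>(l, i, a). (i + a, l - a, a)"])
      (auto intro!: arg_cong2[where f = ?P] arg_cong2[where f = ?g])
  also have "\<dots> = hpure sV' sW' (F X) (G Y) n"
    by (simp add: hext_hcoeff[OF F m(1,3)] hext_hcoeff[OF G m(2,4)] hext_def hpure_def sl sr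
        sum.Sigma sum.cartesian_product)
  finally show "htensor_map sV' sW' F G (hpure sV sW X Y) n = hpure sV' sW' (F X) (G Y) n" .
qed

end

theory Submission
  imports Defs
begin

text \<open>
  Write \<open>p\<close> for the coderivations, and let \<open>\<mu>\<close> and \<open>\<delta>\<close> be the deformed multiplication and
  comultiplication as functions of the formal parameter \<open>h\<close>. They are exponentials, so they solve

    \<open>\<mu>' x y = \<mu> (d\<^sub>1 x) (d\<^sub>2 y)\<close>  and  \<open>\<delta>' x = (p\<^sub>1 \<otimes> p\<^sub>2) (\<delta> x)\<close>,

  where the prime is the derivative in \<open>h\<close>, and they start at the given structure for \<open>h = 0\<close>. The
  proof treats the theorem as a statement about this flow.

  First, the hypotheses persist along the flow: for all \<open>h\<close> the pairs \<open>(d\<^sub>1, p\<^sub>1)\<close> and \<open>(d\<^sub>2,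
  p\<^sub>2)\<close> stay coherent for \<open>\<mu>\<close> and \<open>\<delta>\<close>, and the exchange relations \<open>\<mu> (d\<^sub>1 x) (d\<^sub>2 y) = p\<^sub>2 (\<mu> x
  (d\<^sub>1 y)) = p\<^sub>1 (\<mu> (d\<^sub>2 x) y)\<close> and \<open>(p\<^sub>1 \<otimes> p\<^sub>2) \<delta> = (id \<otimes> p\<^sub>1) \<delta> d\<^sub>2 = (p\<^sub>2 \<otimes> id) \<delta> d\<^sub>1\<close> continue
  to hold. This is not obvious, as \<open>d\<^sub>i\<close> need not commute with \<open>p\<^sub>j\<close>; but the exchange relations
  provide three forms of \<open>\<mu>'\<close> and of \<open>\<delta>'\<close>, and for each identity one of them needs only the given
  commutations (\<open>coherent_mult_step\<close>, \<open>coherent_comult_step\<close>).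

  Secondly, the defect \<open>E\<close> of each axiom of an ASI bialgebra satisfies a homogeneous linear
  differential equation along the flow. For the derivation condition, with defect \<open>E x y = \<delta> (\<mu> x
  y) - (id \<otimes> L x) (\<delta> y) - (R y \<otimes> id) (\<delta> x)\<close>, where \<open>L\<close> and \<open>R\<close> are left and right multiplication
  for \<open>\<mu>\<close>, it is

    \<open>E' x y = (id \<otimes> p\<^sub>1) (E (d\<^sub>2 x) y + E x (d\<^sub>2 y)) + E (d\<^sub>1 x) (d\<^sub>2 y)\<close>,

  and for the antisymmetry condition it is

    \<open>E' x y = (id \<otimes> p\<^sub>1) (E (d\<^sub>2 x) y) + (id \<otimes> p\<^sub>2) (E x (d\<^sub>1 y)) + E (d\<^sub>2 x) (d\<^sub>1 y)\<close>.

  These equations hold term by term. Choosing among the three forms of \<open>\<mu>'\<close> and \<open>\<delta>'\<close>, each term is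
  differentiated in the way that fits, for example \<open>(id \<otimes> L x) (\<delta>' y) = (id \<otimes> L x p\<^sub>1) (\<delta> (d\<^sub>2
  y))\<close> followed by \<open>\<mu> x (p\<^sub>1 z) = \<mu> (d\<^sub>1 x) z + p\<^sub>1 (\<mu> x z)\<close>. Associativity and coassociativity
  are similar and rest on the Leibniz rules and their duals. Since \<open>E = 0\<close> at \<open>h = 0\<close> and the
  characteristic is \<open>0\<close>, the differential equation gives \<open>E = 0\<close> by induction on the coefficients
  (\<open>Cauchy_product_flow_zero\<close>).

  The argument is carried out on coefficients: the term-by-term identities hold for each pair of a
  coefficient of \<open>\<delta>\<close> and one of \<open>\<mu>\<close>. The last part of the proof passes from coefficients to the
  extended operations on \<open>A[[h]]\<close>.
\<close>

section \<open>Tensor products of linear maps\<close>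

lemma tensor_map_add: "tensor_map sV sW f g (T + U) =
  tensor_map sV sW f g T + tensor_map sV sW f g U"
  by (auto simp: tensor_map_def fun_eq_iff)

lemma tensor_map_diff: "tensor_map sV sW f g (T - U) =
  tensor_map sV sW f g T - tensor_map sV sW f g U"
  by (auto simp: tensor_map_def fun_eq_iff)

lemma tensor_map_zero: "tensor_map sV sW f g 0 = 0"
  by (auto simp: tensor_map_def fun_eq_iff)

lemma tensor_map_scale:
  "tensor_map sV sW f g (fun_scale c T) = fun_scale c (tensor_map sV sW f g T)"
  by (auto simp: tensor_map_def fun_scale_def fun_eq_iff)

lemma linear_tensor_map: "module_hom fun_scale fun_scale (tensor_map sV sW f g)"
  by (intro module_hom.intro module_hom_axioms.intro tensor_map_add tensor_map_scale)
    (simp_all only: module_iff_vector_space vector_space_fun_scale)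

lemma tensor_map_comp:
  assumes "module_hom sV sV' f" "module_hom sW sW' g"
  shows "tensor_map sV' sW' f g (tensor_map sV sW f' g' T) =
    tensor_map sV' sW' (\<lambda>x. f (f' x)) (\<lambda>y. g (g' y)) T"
  by (auto simp: tensor_map_def fun_eq_iff bilin_comp[OF _ assms])

lemma tensor_map_in_tensor:
  assumes "module_hom sV sV' f" "module_hom sW sW' g" "T \<in> tensor sV sW"
  shows "tensor_map sV' sW' f g T \<in> tensor sV' sW'"
proof -
  interpret A: vector_space "fun_scale :: 'a \<Rightarrow> ('a, 'b, 'd) tens \<Rightarrow> _"
    by (rule vector_space_fun_scale)
  interpret B: vector_space "fun_scale :: 'a \<Rightarrow> ('a, 'c, 'e) tens \<Rightarrow> _"
    by (rule vector_space_fun_scale)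
  note f = assms(1,2)[unfolded module_hom_iff_linear]
  show ?thesis
    using assms(3) unfolding tensor_def
  proof (induction rule: A.span_induct_alt)
    case base
    then show ?case by (simp only: tensor_map_zero B.span_zero)
  next
    case (step c P T)
    then obtain x y where P: "P = pure sV sW x y" by blast
    have "pure sV' sW' (f x) (g y) \<in> B.span {pure sV' sW' x y | x y. True}"
      by (rule B.span_base) blast
    then show ?case
      unfolding P tensor_map_add tensor_map_scale tensor_map_pure[OF f]
      by (intro B.span_add B.span_scale step.IH)
  qed
qed

lemma bilinD:
  assumes "bilin sU sV sW \<beta>"
  shows "\<beta> (x + x') y = \<beta> x y + \<beta> x' y" "\<beta> x (y + y') = \<beta> x y + \<beta> x y'"
    "\<beta> (sU c x) y = sW c (\<beta> x y)" "\<beta> x (sV c y) = sW c (\<beta> x y)"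
  using assms module_hom.add[of sU sW "\<lambda>x. \<beta> x y"] module_hom.scale[of sU sW "\<lambda>x. \<beta> x y"]
    module_hom.add[of sV sW "\<beta> x"] module_hom.scale[of sV sW "\<beta> x"]
  by (simp_all add: bilin_def)

text \<open>
  Additivity in the tensor is immediate from the pointwise definition. Additivity and homogeneity
  in the maps need more: they express that an element of the tensor product is a linear functional
    on
  the space of bilinear forms.
\<close>

lemma tensor_map_add_left:
  assumes "module_hom sV sV' f" "module_hom sV sV' f'" "module_hom sW sW' g" "T \<in> tensor sV sW"
  shows "tensor_map sV' sW' (\<lambda>x. f x + f' x) g T =
    tensor_map sV' sW' f g T + tensor_map sV' sW' f' g T"
proof
  fix \<beta>
  show "tensor_map sV' sW' (\<lambda>x. f x + f' x) g T \<beta> =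
    (tensor_map sV' sW' f g T + tensor_map sV' sW' f' g T) \<beta>"
  proof (cases "bilin sV' sW' (*) \<beta>")
    case True
    then have "\<beta> (f x + f' x) (g y) = \<beta> (f x) (g y) + \<beta> (f' x) (g y)" for x y
      by (rule bilinD)
    then show ?thesis
      using True tensor_linear(1)[OF assms(4) bilin_comp[OF True assms(1,3)]
          bilin_comp[OF True assms(2,3)]]
      by (simp add: tensor_map_def)
  qed (simp add: tensor_map_def)
qed

lemma tensor_map_add_right:
  assumes "module_hom sV sV' f" "module_hom sW sW' g" "module_hom sW sW' g'" "T \<in> tensor sV sW"
  shows "tensor_map sV' sW' f (\<lambda>y. g y + g' y) T =
    tensor_map sV' sW' f g T + tensor_map sV' sW' f g' T"
proof
  fix \<beta>
  show "tensor_map sV' sW' f (\<lambda>y. g y + g' y) T \<beta> =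
    (tensor_map sV' sW' f g T + tensor_map sV' sW' f g' T) \<beta>"
  proof (cases "bilin sV' sW' (*) \<beta>")
    case True
    then have "\<beta> (f x) (g y + g' y) = \<beta> (f x) (g y) + \<beta> (f x) (g' y)" for x y
      by (rule bilinD)
    then show ?thesis
      using True tensor_linear(1)[OF assms(4) bilin_comp[OF True assms(1,2)]
          bilin_comp[OF True assms(1,3)]]
      by (simp add: tensor_map_def)
  qed (simp add: tensor_map_def)
qed

lemma tensor_map_scale_left:
  assumes "module_hom sV sV' f" "module_hom sW sW' g" "T \<in> tensor sV sW"
  shows "tensor_map sV' sW' (\<lambda>x. sV' c (f x)) g T = fun_scale c (tensor_map sV' sW' f g T)"
proof
  fix \<beta>
  show "tensor_map sV' sW' (\<lambda>x. sV' c (f x)) g T \<beta> = fun_scale c (tensor_map sV' sW' f g T) \<beta>"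
  proof (cases "bilin sV' sW' (*) \<beta>")
    case True
    then have "\<beta> (sV' c (f x)) (g y) = c * \<beta> (f x) (g y)" for x y
      by (rule bilinD)
    then show ?thesis
      using True tensor_linear(2)[OF assms(3) bilin_comp[OF True assms(1,2)]
          bilin_comp[OF True assms(1,2)]]
      by (simp add: tensor_map_def fun_scale_def)
  qed (simp add: tensor_map_def fun_scale_def)
qed

lemma tensor_map_scale_right:
  assumes "module_hom sV sV' f" "module_hom sW sW' g" "T \<in> tensor sV sW"
  shows "tensor_map sV' sW' f (\<lambda>x. sW' c (g x)) T = fun_scale c (tensor_map sV' sW' f g T)"
proof
  fix \<beta>
  show "tensor_map sV' sW' f (\<lambda>x. sW' c (g x)) T \<beta> = fun_scale c (tensor_map sV' sW' f g T) \<beta>"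
  proof (cases "bilin sV' sW' (*) \<beta>")
    case True
    then have "\<beta> (f x) (sW' c (g y)) = c * \<beta> (f x) (g y)" for x y
      by (rule bilinD)
    then show ?thesis
      using True tensor_linear(2)[OF assms(3) bilin_comp[OF True assms(1,2)]
          bilin_comp[OF True assms(1,2)]]
      by (simp add: tensor_map_def fun_scale_def)
  qed (simp add: tensor_map_def fun_scale_def)
qed

lemma tensor_flip_add: "tensor_flip (T + U) = tensor_flip T + tensor_flip U"
  by (auto simp: tensor_flip_def fun_eq_iff)

lemma tensor_flip_diff: "tensor_flip (T - U) = tensor_flip T - tensor_flip U"
  by (auto simp: tensor_flip_def fun_eq_iff)

lemma tensor_flip_scale: "tensor_flip (fun_scale c T) = fun_scale c (tensor_flip T)"
  by (auto simp: tensor_flip_def fun_scale_def fun_eq_iff)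

lemma tensor_flip_sum: "tensor_flip (\<Sum>i\<in>I. T i) = (\<Sum>i\<in>I. tensor_flip (T i))"
  by (rule ext) (simp only: tensor_flip_def sum_fun_apply)

lemma bilin_flip: "bilin sW sV sU (\<lambda>x y. \<beta> y x) \<longleftrightarrow> bilin sV sW sU \<beta>"
  by (auto simp: bilin_def)

lemma tensor_map_flip: "tensor_map sV sW f g (tensor_flip T) = tensor_flip (tensor_map sW sV g f T)"
proof
  fix \<beta>
  show "tensor_map sV sW f g (tensor_flip T) \<beta> = tensor_flip (tensor_map sW sV g f T) \<beta>"
    by (simp only: tensor_map_def tensor_flip_def bilin_flip[of sW sV _ \<beta>])
qed

section \<open>Coherent multiplications and comultiplications\<close>

text \<open>
  The four maps of the theorem without any multiplication or comultiplication. Structures on \<open>A\<close>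
  are kept as arguments of predicates below, because the deformed coefficients all have to be
  compared with the same \<open>(d\<^sub>1, p\<^sub>1)\<close> and \<open>(d\<^sub>2, p\<^sub>2)\<close>.
\<close>

locale commuting_pairs =
  fixes s :: "'k::field_char_0 \<Rightarrow> 'a::ab_group_add \<Rightarrow> 'a"
    and d1 d2 p1 p2 :: "'a \<Rightarrow> 'a"
  assumes hom: "module_hom s s d1" "module_hom s s d2" "module_hom s s p1" "module_hom s s p2"
    and d_commute: "d1 (d2 x) = d2 (d1 x)"
    and p_commute: "p1 (p2 x) = p2 (p1 x)"
begin

sublocale vector_space s
  using hom(1) by (simp add: module_hom_def module_iff_vector_space)

abbreviation TM :: "('a \<Rightarrow> 'a) \<Rightarrow> ('a \<Rightarrow> 'a) \<Rightarrow> ('k, 'a, 'a) tens \<Rightarrow> ('k, 'a, 'a) tens"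
  where "TM \<equiv> tensor_map s s"

lemma hom_id: "module_hom s s id" "module_hom s s (\<lambda>x. x)"
  using module_axioms by (auto simp: module_hom_def module_hom_axioms_def)

text \<open>Composition produces \<open>\<lambda>x. x\<close> where the statements have \<open>id\<close>.\<close>

lemma TM_id: "TM (\<lambda>x. x) = TM id" "TM f (\<lambda>x. x) = TM f id"
  by (auto simp: id_def)

text \<open>
  The hypotheses of the theorem, split into those on the multiplication and those on the
  comultiplication, with associativity, coassociativity and the two compatibility conditions left
  out. What remains is linear in \<open>\<mu>\<close> and in \<open>\<delta>\<close>, respectively, so that it makes sense, and will be
  true, for each single coefficient of the deformed operations.
\<close>

definition coherent_mult :: "('a \<Rightarrow> 'a \<Rightarrow> 'a) \<Rightarrow> bool" where
  "coherent_mult \<mu> \<longleftrightarrow> bilin s s s \<mu> \<and>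
     (\<forall>d p x y. (d, p) \<in> {(d1, p1), (d2, p2)} \<longrightarrow>
        d (\<mu> x y) = \<mu> (d x) y + \<mu> x (d y) \<and>
        \<mu> (p x) y = \<mu> x (d y) + p (\<mu> x y) \<and>
        \<mu> x (p y) = \<mu> (d x) y + p (\<mu> x y)) \<and>
     (\<forall>x y. \<mu> (d1 x) (d2 y) = p2 (\<mu> x (d1 y)) \<and> \<mu> (d1 x) (d2 y) = p1 (\<mu> (d2 x) y))"

definition coherent_comult :: "('a \<Rightarrow> ('k, 'a, 'a) tens) \<Rightarrow> bool" where
  "coherent_comult \<delta> \<longleftrightarrow> module_hom s fun_scale \<delta> \<and> (\<forall>x. \<delta> x \<in> tensor s s) \<and>
     (\<forall>d p x. (d, p) \<in> {(d1, p1), (d2, p2)} \<longrightarrow>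
        \<delta> (p x) = TM p id (\<delta> x) + TM id p (\<delta> x) \<and>
        TM d id (\<delta> x) = TM id p (\<delta> x) + \<delta> (d x) \<and>
        TM id d (\<delta> x) = TM p id (\<delta> x) + \<delta> (d x)) \<and>
     (\<forall>x. TM p1 p2 (\<delta> x) = TM id p1 (\<delta> (d2 x)) \<and> TM p1 p2 (\<delta> x) = TM p2 id (\<delta> (d1 x)))"

lemma coherent_multD:
  assumes "coherent_mult \<mu>"
  shows "module_hom s s (\<mu> x)" "module_hom s s (\<lambda>x. \<mu> x y)"
    "d1 (\<mu> x y) = \<mu> (d1 x) y + \<mu> x (d1 y)" "d2 (\<mu> x y) = \<mu> (d2 x) y + \<mu> x (d2 y)"
    "\<mu> (p1 x) y = \<mu> x (d1 y) + p1 (\<mu> x y)" "\<mu> (p2 x) y = \<mu> x (d2 y) + p2 (\<mu> x y)"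
    "\<mu> x (p1 y) = \<mu> (d1 x) y + p1 (\<mu> x y)" "\<mu> x (p2 y) = \<mu> (d2 x) y + p2 (\<mu> x y)"
    "\<mu> (d1 x) (d2 y) = p2 (\<mu> x (d1 y))" "\<mu> (d1 x) (d2 y) = p1 (\<mu> (d2 x) y)"
proof -
  note A = assms[unfolded coherent_mult_def bilin_def]
  note B = A[THEN conjunct2, THEN conjunct1, rule_format]
  note C = A[THEN conjunct2, THEN conjunct2, rule_format]
  show "module_hom s s (\<mu> x)" "module_hom s s (\<lambda>x. \<mu> x y)"
    using A by blast+
  show "d1 (\<mu> x y) = \<mu> (d1 x) y + \<mu> x (d1 y)" "d2 (\<mu> x y) = \<mu> (d2 x) y + \<mu> x (d2 y)"
    "\<mu> (p1 x) y = \<mu> x (d1 y) + p1 (\<mu> x y)" "\<mu> (p2 x) y = \<mu> x (d2 y) + p2 (\<mu> x y)"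
    "\<mu> x (p1 y) = \<mu> (d1 x) y + p1 (\<mu> x y)" "\<mu> x (p2 y) = \<mu> (d2 x) y + p2 (\<mu> x y)"
    using B[of d1 p1 x y] B[of d2 p2 x y] by simp_all
  show "\<mu> (d1 x) (d2 y) = p2 (\<mu> x (d1 y))" "\<mu> (d1 x) (d2 y) = p1 (\<mu> (d2 x) y)"
    using C[of x y] by (rule conjunct1, rule conjunct2)
qed

lemma coherent_comultD:
  assumes "coherent_comult \<delta>"
  shows "module_hom s fun_scale \<delta>" "\<delta> x \<in> tensor s s"
    "\<delta> (p1 x) = TM p1 id (\<delta> x) + TM id p1 (\<delta> x)" "\<delta> (p2 x) = TM p2 id (\<delta> x) + TM id p2 (\<delta> x)"
    "TM d1 id (\<delta> x) = TM id p1 (\<delta> x) + \<delta> (d1 x)" "TM d2 id (\<delta> x) = TM id p2 (\<delta> x) + \<delta> (d2 x)"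
    "TM id d1 (\<delta> x) = TM p1 id (\<delta> x) + \<delta> (d1 x)" "TM id d2 (\<delta> x) = TM p2 id (\<delta> x) + \<delta> (d2 x)"
    "TM p1 p2 (\<delta> x) = TM id p1 (\<delta> (d2 x))" "TM p1 p2 (\<delta> x) = TM p2 id (\<delta> (d1 x))"
proof -
  note A = assms[unfolded coherent_comult_def]
  note B = A[THEN conjunct2, THEN conjunct2, THEN conjunct1, rule_format]
  note C = A[THEN conjunct2, THEN conjunct2, THEN conjunct2, rule_format]
  show "module_hom s fun_scale \<delta>" "\<delta> x \<in> tensor s s"
    using A by blast+
  show "\<delta> (p1 x) = TM p1 id (\<delta> x) + TM id p1 (\<delta> x)" "\<delta> (p2 x) = TM p2 id (\<delta> x) + TM id p2 (\<delta> x)"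
    "TM d1 id (\<delta> x) = TM id p1 (\<delta> x) + \<delta> (d1 x)" "TM d2 id (\<delta> x) = TM id p2 (\<delta> x) + \<delta> (d2 x)"
    "TM id d1 (\<delta> x) = TM p1 id (\<delta> x) + \<delta> (d1 x)" "TM id d2 (\<delta> x) = TM p2 id (\<delta> x) + \<delta> (d2 x)"
    using B[of d1 p1 x] B[of d2 p2 x] by simp_all
  show "TM p1 p2 (\<delta> x) = TM id p1 (\<delta> (d2 x))" "TM p1 p2 (\<delta> x) = TM p2 id (\<delta> (d1 x))"
    using C[of x] by (rule conjunct1, rule conjunct2)
qed

lemmas hom_simps = hom[THEN module_hom.add] hom[THEN module_hom.scale]

lemma coherent_mult_scale:
  assumes "coherent_mult \<mu>"
  shows "coherent_mult (\<lambda>x y. s c (\<mu> x y))"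
proof -
  note * = coherent_multD[OF assms]
  have "bilin s s s (\<lambda>x y. s c (\<mu> x y))"
    using *(1,2) unfolding bilin_def module_hom_def module_hom_axioms_def
    by (simp add: scale_right_distrib scale_left_commute)
  then show ?thesis
    using *(3-) hom by (auto simp: coherent_mult_def hom_simps scale_right_distrib)
qed

lemma coherent_comult_scale:
  assumes "coherent_comult \<delta>"
  shows "coherent_comult (\<lambda>x. fun_scale c (\<delta> x))"
proof -
  note * = coherent_comultD[OF assms]
  interpret T: vector_space "fun_scale :: 'k \<Rightarrow> ('k, 'a, 'a) tens \<Rightarrow> _"
    by (rule vector_space_fun_scale)
  have "module_hom s fun_scale (\<lambda>x. fun_scale c (\<delta> x))"
    using *(1) unfolding module_hom_def module_hom_axioms_def
    by (simp add: T.scale_right_distrib T.scale_left_commute)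
  moreover have "fun_scale c (\<delta> x) \<in> tensor s s" for x
    using *(2) unfolding tensor_def by (rule T.span_scale)
  ultimately show ?thesis
    using *(3-) by (auto simp: coherent_comult_def hom_simps T.scale_right_distrib tensor_map_scale)
qed

text \<open>
  The exchange relations make this work. A direct check of coherence of \<open>\<mu> (d\<^sub>1 x) (d\<^sub>2 y)\<close> with
  \<open>(d, p)\<close> would require \<open>d\<close> to commute with \<open>p\<close>, which is not given; but \<open>\<mu> (d\<^sub>1 x) (d\<^sub>2 y)\<close> also
  equals \<open>p\<^sub>2 (\<mu> x (d\<^sub>1 y))\<close>. When \<open>p\<close> acts on the left factor, it only has to be moved past \<open>p\<^sub>2\<close>
  in this form, and \<open>d\<close> past \<open>d\<^sub>1\<close>. The other form is \<open>p\<^sub>1 (\<mu> (d\<^sub>2 x) y)\<close>, and it serves in the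
  same way for the right factor.
\<close>

lemma coherent_mult_step:
  assumes "coherent_mult \<mu>"
  shows "coherent_mult (\<lambda>x y. \<mu> (d1 x) (d2 y))"
proof -
  note * = coherent_multD[OF assms]
  have b: "bilin s s s (\<lambda>x y. \<mu> (d1 x) (d2 y))"
    using assms unfolding coherent_mult_def by (intro bilin_comp[OF _ hom(1,2)]) (rule conjunct1)
  have left: "\<mu> (d1 (p x)) (d2 y) = \<mu> (d1 x) (d2 (d y)) + p (\<mu> (d1 x) (d2 y))"
    if "(d, p) \<in> {(d1, p1), (d2, p2)}" for d p x y
  proof -
    have "\<mu> (d1 (p x)) (d2 y) = p2 (\<mu> x (d1 (d y)) + p (\<mu> x (d1 y)))"
      unfolding *(9) using that *(5,6) d_commute by auto
    also have "\<dots> = \<mu> (d1 x) (d2 (d y)) + p (\<mu> (d1 x) (d2 y))"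
      unfolding *(9) using that p_commute hom by (auto simp: hom_simps)
    finally show ?thesis .
  qed
  have right: "\<mu> (d1 x) (d2 (p y)) = \<mu> (d1 (d x)) (d2 y) + p (\<mu> (d1 x) (d2 y))"
    if "(d, p) \<in> {(d1, p1), (d2, p2)}" for d p x y
  proof -
    have "\<mu> (d1 x) (d2 (p y)) = p1 (\<mu> (d2 (d x)) y + p (\<mu> (d2 x) y))"
      unfolding *(10) using that *(7,8) d_commute by auto
    also have "\<dots> = \<mu> (d1 (d x)) (d2 y) + p (\<mu> (d1 x) (d2 y))"
      unfolding *(10) using that p_commute hom by (auto simp: hom_simps)
    finally show ?thesis .
  qed
  have der: "d (\<mu> (d1 x) (d2 y)) = \<mu> (d1 (d x)) (d2 y) + \<mu> (d1 x) (d2 (d y))"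
    if "(d, p) \<in> {(d1, p1), (d2, p2)}" for d p x y
    using that *(3,4) d_commute by auto
  have ex: "\<mu> (d1 (d1 x)) (d2 (d2 y)) = p2 (\<mu> (d1 x) (d2 (d1 y)))"
    "\<mu> (d1 (d1 x)) (d2 (d2 y)) = p1 (\<mu> (d1 (d2 x)) (d2 y))" for x y
    using *(9)[of "d1 x" "d2 y"] *(10)[of "d1 x" "d2 y"] by (simp_all only: d_commute)
  show ?thesis
    unfolding coherent_mult_def
    by (intro conjI allI impI) (assumption | rule b left right der ex)+
qed

text \<open>
  The dual argument: \<open>(d \<otimes> id)\<close> commutes with \<open>(id \<otimes> p\<^sub>1)\<close>, so the first exchange relation handles
  \<open>d\<close> in the left slot, and the second one handles \<open>d\<close> in the right slot.
\<close>

lemma coherent_comult_step: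
  assumes "coherent_comult \<delta>"
  shows "coherent_comult (\<lambda>x. TM p1 p2 (\<delta> x))"
proof -
  note * = coherent_comultD[OF assms]
  have comp: "TM f g (TM f' g' T) = TM (\<lambda>x. f (f' x)) (\<lambda>y. g (g' y)) T"
    if "module_hom s s f" "module_hom s s g" for f g f' g' T
    using that by (rule tensor_map_comp)
  have coder: "TM p1 p2 (\<delta> (p x)) = TM p id (TM p1 p2 (\<delta> x)) + TM id p (TM p1 p2 (\<delta> x))"
    if "(d, p) \<in> {(d1, p1), (d2, p2)}" for d p x
    using that *(3,4) hom by (auto simp: tensor_map_add comp hom_id p_commute)
  have left: "TM d id (TM p1 p2 (\<delta> x)) = TM id p (TM p1 p2 (\<delta> x)) + TM p1 p2 (\<delta> (d x))"
    if "(d, p) \<in> {(d1, p1), (d2, p2)}" for d p x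
  proof -
    have "TM d id (TM p1 p2 (\<delta> x)) = TM id p1 (TM d id (\<delta> (d2 x)))"
      unfolding *(9) using that hom by (auto simp: comp hom_id)
    also have "TM d id (\<delta> (d2 x)) = TM id p (\<delta> (d2 x)) + \<delta> (d2 (d x))"
      using that *(5,6) d_commute by auto
    also have "TM id p1 (TM id p (\<delta> (d2 x)) + \<delta> (d2 (d x))) =
        TM id p (TM p1 p2 (\<delta> x)) + TM p1 p2 (\<delta> (d x))"
      unfolding *(9) using that hom by (auto simp: tensor_map_add comp hom_id p_commute)
    finally show ?thesis .
  qed
  have right: "TM id d (TM p1 p2 (\<delta> x)) = TM p id (TM p1 p2 (\<delta> x)) + TM p1 p2 (\<delta> (d x))"
    if "(d, p) \<in> {(d1, p1), (d2, p2)}" for d p x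
  proof -
    have "TM id d (TM p1 p2 (\<delta> x)) = TM p2 id (TM id d (\<delta> (d1 x)))"
      unfolding *(10) using that hom by (auto simp: comp hom_id)
    also have "TM id d (\<delta> (d1 x)) = TM p id (\<delta> (d1 x)) + \<delta> (d1 (d x))"
      using that *(7,8) d_commute by auto
    also have "TM p2 id (TM p id (\<delta> (d1 x)) + \<delta> (d1 (d x))) =
        TM p id (TM p1 p2 (\<delta> x)) + TM p1 p2 (\<delta> (d x))"
      unfolding *(10) using that hom by (auto simp: tensor_map_add comp hom_id p_commute)
    finally show ?thesis .
  qed
  have ex: "TM p1 p2 (TM p1 p2 (\<delta> x)) = TM id p1 (TM p1 p2 (\<delta> (d2 x)))"
    "TM p1 p2 (TM p1 p2 (\<delta> x)) = TM p2 id (TM p1 p2 (\<delta> (d1 x)))" for x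
    by (subst *(9), use hom in \<open>simp add: comp hom_id p_commute\<close>)
      (subst *(10), use hom in \<open>simp add: comp hom_id p_commute\<close>)
  have lin: "module_hom s fun_scale (\<lambda>x. TM p1 p2 (\<delta> x))"
    using module_hom_compose[OF *(1) linear_tensor_map] by (simp add: o_def)
  show ?thesis
    unfolding coherent_comult_def
    by (intro conjI allI impI)
      (assumption | rule lin tensor_map_in_tensor[OF hom(3,4) *(2)] coder left right ex)+
qed

end

section \<open>Uniqueness of flows\<close>

text \<open>
  This is uniqueness for the linear differential equation \<open>E' = \<Lambda> E\<close> in formal power series: if
  \<open>E(h) = (\<Sum>i j. e i j h^(i + j))\<close>, then \<open>E(0) = 0\<close> forces \<open>E = 0\<close> in characteristic \<open>0\<close>. The
  double index keeps the coefficients of the two factors of a composite apart, so that the product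
  rule for the derivative appears in \<open>step\<close> as a statement about one pair of coefficients at a
  time.
\<close>

lemma Cauchy_product_flow_zero:
  fixes sc :: "'k::field_char_0 \<Rightarrow> 'w::ab_group_add \<Rightarrow> 'w" and e :: "nat \<Rightarrow> nat \<Rightarrow> 'p \<Rightarrow> 'w"
  assumes "vector_space sc"
    and step: "\<And>i j z. sc (of_nat (Suc i)) (e (Suc i) j z) + sc (of_nat (Suc j)) (e i (Suc j) z) =
      \<Lambda> (e i j) z"
    and add: "\<And>f g. \<Lambda> (\<lambda>z. f z + g z) = (\<lambda>z. \<Lambda> f z + \<Lambda> g z)"
    and zero: "\<And>z. e 0 0 z = 0"
  shows "(\<Sum>i\<le>n. e i (n - i) z) = 0"
proof (induction n arbitrary: z)
  case 0
  then show ?case by (simp add: zero)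
next
  case (Suc n)
  interpret vector_space sc by fact
  have \<Lambda>0: "\<Lambda> (\<lambda>z. 0) = (\<lambda>z. 0)"
  proof
    fix z show "\<Lambda> (\<lambda>z. 0) z = 0"
      using fun_cong[OF add[of "\<lambda>z. 0" "\<lambda>z. 0"], of z] by simp
  qed
  have \<Lambda>sum: "\<Lambda> (\<lambda>z. \<Sum>i\<in>I. f i z) z = (\<Sum>i\<in>I. \<Lambda> (f i) z)" if "finite I" for I :: "nat set" and f z
    using that by (induction I) (simp_all add: \<Lambda>0 add)
  let ?f = "\<lambda>i. e i (Suc n - i) z"
  \<comment> \<open>The weight \<open>n + 1 = i + (n + 1 - i)\<close> of the derivative is distributed over the two indices.\<close>
  have "sc (of_nat (Suc n)) (\<Sum>i\<le>Suc n. ?f i)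
      = (\<Sum>i\<le>Suc n. sc (of_nat i) (?f i) + sc (of_nat (Suc n - i)) (?f i))"
    unfolding scale_sum_right
    by (intro sum.cong refl) (simp flip: scale_left_distrib of_nat_add)
  also have "\<dots> = (\<Sum>i\<le>Suc n. sc (of_nat i) (?f i)) + (\<Sum>i\<le>Suc n. sc (of_nat (Suc n - i)) (?f i))"
    by (rule sum.distrib)
  also have "(\<Sum>i\<le>Suc n. sc (of_nat i) (?f i)) = (\<Sum>i\<le>n. sc (of_nat (Suc i)) (e (Suc i) (n - i) z))"
    by (subst sum.atMost_Suc_shift) simp
  also have "(\<Sum>i\<le>Suc n. sc (of_nat (Suc n - i)) (?f i)) = (\<Sum>i\<le>n. sc (of_nat (Suc n - i)) (?f i))"
    by simp
  also have "\<dots> = (\<Sum>i\<le>n. sc (of_nat (Suc (n - i))) (e i (Suc (n - i)) z))"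
    by (intro sum.cong refl) (simp only: Suc_diff_le atMost_iff)
  also have "(\<Sum>i\<le>n. sc (of_nat (Suc i)) (e (Suc i) (n - i) z)) + \<dots> = (\<Sum>i\<le>n. \<Lambda> (e i (n - i)) z)"
    by (simp only: step flip: sum.distrib)
  also have "\<dots> = \<Lambda> (\<lambda>z. \<Sum>i\<le>n. e i (n - i) z) z"
    by (simp add: \<Lambda>sum)
  also have "\<dots> = 0"
    by (simp add: Suc.IH \<Lambda>0)
  finally show ?case
    by (simp del: of_nat_Suc)
qed

section \<open>The infinitesimal identities\<close>

context commuting_pairs
begin

text \<open>
  The next seven identities are the derivatives of the terms of the two compatibility conditions.
  Writing \<open>\<mu>' x y = \<mu> (d\<^sub>1 x) (d\<^sub>2 y)\<close> and \<open>\<delta>' x = (p\<^sub>1 \<otimes> p\<^sub>2) (\<delta> x)\<close> for the derivatives in \<open>h\<close>,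
  each left-hand side differentiates one term by the product rule. The right-hand sides have the
  same shape for all terms of a condition: \<open>(id \<otimes> p\<^sub>1)\<close> on the term at \<open>(d\<^sub>2 x, y)\<close> and at \<open>(x,
  d\<^sub>2 y)\<close>, plus the term at \<open>(d\<^sub>1 x, d\<^sub>2 y)\<close>, for the derivation condition; and \<open>(id \<otimes> p\<^sub>1)\<close> at
  \<open>(d\<^sub>2 x, y)\<close>, \<open>(id \<otimes> p\<^sub>2)\<close> at \<open>(x, d\<^sub>1 y)\<close>, plus the term at \<open>(d\<^sub>2 x, d\<^sub>1 y)\<close>, for the
  antisymmetry condition.
\<close>

lemma flow_comult_of_mult:
  assumes "coherent_mult \<mu>" "coherent_comult \<delta>"
  shows "TM p1 p2 (\<delta> (\<mu> x y)) + \<delta> (\<mu> (d1 x) (d2 y)) =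
    TM id p1 (\<delta> (\<mu> (d2 x) y) + \<delta> (\<mu> x (d2 y))) + \<delta> (\<mu> (d1 x) (d2 y))"
  by (simp only: coherent_multD(4)[OF assms(1)] coherent_comultD(9)[OF assms(2)]
    module_hom.add[OF coherent_comultD(1)[OF assms(2)]])

lemma TM_comp:
  assumes "module_hom s s f" "module_hom s s g"
  shows "TM f g (TM f' g' T) = TM (\<lambda>x. f (f' x)) (\<lambda>y. g (g' y)) T"
  using assms by (rule tensor_map_comp)

lemmas TM_simps = tensor_map_add tensor_map_diff TM_comp hom hom_id TM_id id_apply

lemma hom_comp:
  assumes "module_hom s s f" "module_hom s s g"
  shows "module_hom s s (\<lambda>x. f (g x))"
  using module_hom_compose[OF assms(2,1)] by (simp add: o_def)

lemma flow_right_mult_left_factor: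
  assumes \<mu>: "coherent_mult \<mu>" and \<delta>: "coherent_comult \<delta>"
  shows "TM (\<lambda>z. \<mu> z y) id (TM p1 p2 (\<delta> x)) + TM (\<lambda>z. \<mu> (d1 z) (d2 y)) id (\<delta> x) =
    TM id p1 (TM (\<lambda>z. \<mu> z y) id (\<delta> (d2 x)) + TM (\<lambda>z. \<mu> z (d2 y)) id (\<delta> x))
    + TM (\<lambda>z. \<mu> z (d2 y)) id (\<delta> (d1 x))"
proof -
  note m = coherent_multD[OF \<mu>] and c = coherent_comultD[OF \<delta>]
  have "TM (\<lambda>z. \<mu> (d1 z) (d2 y)) id (\<delta> x) = TM (\<lambda>z. \<mu> z (d2 y)) id (TM d1 id (\<delta> x))"
    using m(2) by (simp only: TM_simps)
  then show ?thesis
    using m(2) by (simp only: c(5,9) TM_simps add.assoc)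
qed

lemma flow_left_mult_right_factor:
  assumes \<mu>: "coherent_mult \<mu>" and \<delta>: "coherent_comult \<delta>"
  shows "TM id (\<mu> x) (TM p1 p2 (\<delta> y)) + TM id (\<lambda>z. \<mu> (d1 x) (d2 z)) (\<delta> y) =
    TM id p1 (TM id (\<mu> (d2 x)) (\<delta> y) + TM id (\<mu> x) (\<delta> (d2 y)))
    + TM id (\<mu> (d1 x)) (\<delta> (d2 y))"
proof -
  note m = coherent_multD[OF \<mu>] and c = coherent_comultD[OF \<delta>]
  have "TM id (\<mu> x) (TM p1 p2 (\<delta> y)) = TM id (\<lambda>z. \<mu> (d1 x) z + p1 (\<mu> x z)) (\<delta> (d2 y))"
    using m(1) by (simp only: c(9) TM_simps m(7))
  also have "\<dots> = TM id (\<mu> (d1 x)) (\<delta> (d2 y)) + TM id (\<lambda>z. p1 (\<mu> x z)) (\<delta> (d2 y))"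
    using m(1) hom c(2) by (intro tensor_map_add_right) (auto intro: hom_comp hom_id)
  finally show ?thesis
    using m(1) by (simp only: TM_simps m(10) add_ac)
qed

lemma flow_left_mult_left_factor:
  assumes \<mu>: "coherent_mult \<mu>" and \<delta>: "coherent_comult \<delta>"
  shows "TM (\<mu> y) id (TM p1 p2 (\<delta> x)) + TM (\<lambda>z. \<mu> (d1 y) (d2 z)) id (\<delta> x) =
    TM id p1 (TM (\<mu> y) id (\<delta> (d2 x))) + TM id p2 (TM (\<mu> (d1 y)) id (\<delta> x))
    + TM (\<mu> (d1 y)) id (\<delta> (d2 x))"
proof -
  note m = coherent_multD[OF \<mu>] and c = coherent_comultD[OF \<delta>]
  have "TM (\<lambda>z. \<mu> (d1 y) (d2 z)) id (\<delta> x) = TM (\<mu> (d1 y)) id (TM d2 id (\<delta> x))"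
    using m(1) by (simp only: TM_simps)
  then show ?thesis
    using m(1) by (simp only: c(6,9) TM_simps add.assoc)
qed

lemma flow_right_mult_right_factor:
  assumes \<mu>: "coherent_mult \<mu>" and \<delta>: "coherent_comult \<delta>"
  shows "TM id (\<lambda>z. \<mu> z y) (TM p1 p2 (\<delta> x)) + TM id (\<lambda>z. \<mu> (d1 z) (d2 y)) (\<delta> x) =
    TM id p1 (TM id (\<lambda>z. \<mu> z y) (\<delta> (d2 x))) + TM id p2 (TM id (\<lambda>z. \<mu> z (d1 y)) (\<delta> x))
    + TM id (\<lambda>z. \<mu> z (d1 y)) (\<delta> (d2 x))"
proof -
  note m = coherent_multD[OF \<mu>] and c = coherent_comultD[OF \<delta>]
  have "TM id (\<lambda>z. \<mu> z y) (TM p1 p2 (\<delta> x)) = TM id (\<lambda>z. \<mu> z (d1 y) + p1 (\<mu> z y)) (\<delta> (d2 x))"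
    using m(2) by (simp only: c(9) TM_simps m(5))
  also have "\<dots> = TM id (\<lambda>z. \<mu> z (d1 y)) (\<delta> (d2 x)) + TM id (\<lambda>z. p1 (\<mu> z y)) (\<delta> (d2 x))"
    using m(2) hom c(2) by (intro tensor_map_add_right) (auto intro: hom_comp hom_id)
  finally show ?thesis
    using m(2) by (simp only: TM_simps m(9) add_ac)
qed

text \<open>
  The two terms of the antisymmetry condition that stand under the flip; the operators \<open>id \<otimes> p\<^sub>i\<close>
  therefore appear as \<open>p\<^sub>i \<otimes> id\<close>.
\<close>

lemma flow_flipped_left_mult_left_factor:
  assumes \<mu>: "coherent_mult \<mu>" and \<delta>: "coherent_comult \<delta>"
  shows "TM (\<mu> x) id (TM p1 p2 (\<delta> y)) + TM (\<lambda>z. \<mu> (d1 x) (d2 z)) id (\<delta> y) =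
    TM p1 id (TM (\<mu> (d2 x)) id (\<delta> y)) + TM p2 id (TM (\<mu> x) id (\<delta> (d1 y)))
    + TM (\<mu> (d2 x)) id (\<delta> (d1 y))"
proof -
  note m = coherent_multD[OF \<mu>] and c = coherent_comultD[OF \<delta>]
  have "TM (\<mu> x) id (TM p1 p2 (\<delta> y)) = TM (\<lambda>z. \<mu> (d2 x) z + p2 (\<mu> x z)) id (\<delta> (d1 y))"
    using m(1) by (simp only: c(10) TM_simps m(8))
  also have "\<dots> = TM (\<mu> (d2 x)) id (\<delta> (d1 y)) + TM (\<lambda>z. p2 (\<mu> x z)) id (\<delta> (d1 y))"
    using m(1) hom c(2) by (intro tensor_map_add_left) (auto intro: hom_comp hom_id)
  finally show ?thesis
    using m(1) by (simp only: TM_simps m(10) add_ac)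
qed

lemma flow_flipped_right_mult_right_factor:
  assumes \<mu>: "coherent_mult \<mu>" and \<delta>: "coherent_comult \<delta>"
  shows "TM id (\<lambda>z. \<mu> z x) (TM p1 p2 (\<delta> y)) + TM id (\<lambda>z. \<mu> (d1 z) (d2 x)) (\<delta> y) =
    TM p1 id (TM id (\<lambda>z. \<mu> z (d2 x)) (\<delta> y)) + TM p2 id (TM id (\<lambda>z. \<mu> z x) (\<delta> (d1 y)))
    + TM id (\<lambda>z. \<mu> z (d2 x)) (\<delta> (d1 y))"
proof -
  note m = coherent_multD[OF \<mu>] and c = coherent_comultD[OF \<delta>]
  have "TM id (\<lambda>z. \<mu> (d1 z) (d2 x)) (\<delta> y) = TM id (\<lambda>z. \<mu> z (d2 x)) (TM id d1 (\<delta> y))"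
    using m(2) by (simp only: TM_simps)
  then show ?thesis
    using m(2) by (simp only: c(7,10) TM_simps add_ac)
qed

end

section \<open>Threefold tensors\<close>

text \<open>
  The map \<open>f \<otimes> g \<otimes> h\<close> on threefold tensors, again by precomposition of trilinear forms.
\<close>

definition tensor3_map ::
  "('k::field \<Rightarrow> 'a::ab_group_add \<Rightarrow> 'a) \<Rightarrow> ('a \<Rightarrow> 'a) \<Rightarrow> ('a \<Rightarrow> 'a) \<Rightarrow> ('a \<Rightarrow> 'a) \<Rightarrow>
   ('k, 'a, 'a, 'a) tens3 \<Rightarrow> ('k, 'a, 'a, 'a) tens3" where
  "tensor3_map s f g h T =
     (\<lambda>\<tau>. if trilin s s s (*) \<tau> then T (\<lambda>x y z. \<tau> (f x) (g y) (h z)) else 0)"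

lemma tensor3_map_add: "tensor3_map s f g h (T + U) = tensor3_map s f g h T + tensor3_map s f g h U"
  by (auto simp: tensor3_map_def fun_eq_iff)

lemma tensor3_map_diff: "tensor3_map s f g h (T - U) =
  tensor3_map s f g h T - tensor3_map s f g h U"
  by (auto simp: tensor3_map_def fun_eq_iff)

lemma trilin_comp:
  assumes "trilin s s s t \<tau>" "module_hom s s f" "module_hom s s g" "module_hom s s h"
  shows "trilin s s s t (\<lambda>x y z. \<tau> (f x) (g y) (h z))"
proof -
  have "module_hom s t (\<lambda>x. \<phi> (k x))" if "module_hom s t \<phi>" "module_hom s s k" for \<phi> k
    using module_hom_compose[OF that(2,1)] by (simp add: o_def)
  then show ?thesis
    using assms unfolding trilin_def by blast
qed

lemma tensor3_map_comp:
  assumes "module_hom s s f" "module_hom s s g" "module_hom s s h"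
  shows "tensor3_map s f g h (tensor3_map s f' g' h' T) =
    tensor3_map s (\<lambda>x. f (f' x)) (\<lambda>x. g (g' x)) (\<lambda>x. h (h' x)) T"
  by (auto simp: tensor3_map_def fun_eq_iff trilin_comp[OF _ assms])

lemma trilin_slice:
  assumes "trilin s s s t \<tau>"
  shows "bilin s s t (\<lambda>u v. \<tau> u v z)" "bilin s s t (\<lambda>u v. \<tau> x u v)"
  using assms by (simp_all add: trilin_def bilin_def)

lemma module_hom_id:
  assumes "module_hom s t f"
  shows "module_hom s s id"
  using assms by (simp add: module_hom_def module_hom_axioms_def)

lemma tensor_left_tensor_map:
  assumes "module_hom s s f" "module_hom s s g"
  shows "tensor_left s (\<lambda>x. tensor_map s s f g (\<delta> x)) T = tensor3_map s f g id (tensor_left s \<delta> T)"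
proof
  fix \<tau>
  show "tensor_left s (\<lambda>x. tensor_map s s f g (\<delta> x)) T \<tau> =
    tensor3_map s f g id (tensor_left s \<delta> T) \<tau>"
  proof (cases "trilin s s s (*) \<tau>")
    case True
    then show ?thesis
      using module_hom_id[OF assms(1)] trilin_comp[OF True assms, of id] trilin_slice(1)[OF True]
      by (simp add: tensor_left_def tensor3_map_def tensor_map_def)
  qed (simp add: tensor_left_def tensor3_map_def)
qed

lemma tensor_right_tensor_map:
  assumes "module_hom s s f" "module_hom s s g"
  shows "tensor_right s (\<lambda>x. tensor_map s s f g (\<delta> x)) T =
    tensor3_map s id f g (tensor_right s \<delta> T)"
proof
  fix \<tau>
  show "tensor_right s (\<lambda>x. tensor_map s s f g (\<delta> x)) T \<tau> =
    tensor3_map s id f g (tensor_right s \<delta> T) \<tau>"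
  proof (cases "trilin s s s (*) \<tau>")
    case True
    then show ?thesis
      using module_hom_id[OF assms(1)] trilin_comp[OF True _ assms, of id] trilin_slice(2)[OF True]
      by (simp add: tensor_right_def tensor3_map_def tensor_map_def)
  qed (simp add: tensor_right_def tensor3_map_def)
qed

text \<open>
  The forms to which a tensor is applied in \<open>tensor_left\<close> and \<open>tensor_right\<close> are bilinear; this is
  what allows a tensor, as a linear functional on such forms, to be manipulated there.
\<close>

lemma bilin_tensor_left:
  assumes \<delta>: "module_hom s fun_scale \<delta>" "\<And>x. \<delta> x \<in> tensor s s" and \<tau>: "trilin s s s (*) \<tau>"
  shows "bilin s s (*) (\<lambda>x z. \<delta> x (\<lambda>u v. \<tau> u v z))"
proof -
  interpret \<delta>: module_hom s fun_scale \<delta> by fact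
  have \<tau>z: "\<tau> u v (z + z') = \<tau> u v z + \<tau> u v z'" "\<tau> u v (s c z) = c * \<tau> u v z" for u v z z' c
    using \<tau> module_hom.add[of s "(*)" "\<lambda>z. \<tau> u v z"] module_hom.scale[of s "(*)" "\<lambda>z. \<tau> u v z"]
    by (simp_all add: trilin_def)
  show ?thesis
    using tensor_linear[OF \<delta>(2) trilin_slice(1)[OF \<tau>] trilin_slice(1)[OF \<tau>]]
      vector_space_mult \<delta>.m1.module_axioms
    by (simp add: bilin_def module_hom_def module_hom_axioms_def module_iff_vector_space
        \<delta>.add \<delta>.scale fun_scale_def \<tau>z)
qed

lemma bilin_tensor_right:
  assumes \<delta>: "module_hom s fun_scale \<delta>" "\<And>x. \<delta> x \<in> tensor s s" and \<tau>: "trilin s s s (*) \<tau>"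
  shows "bilin s s (*) (\<lambda>x z. \<delta> z (\<lambda>u v. \<tau> x u v))"
proof -
  interpret \<delta>: module_hom s fun_scale \<delta> by fact
  have \<tau>x: "\<tau> (x + x') = (\<lambda>u v. \<tau> x u v + \<tau> x' u v)" "\<tau> (s c x) = (\<lambda>u v. c * \<tau> x u v)" for x x' c
    using \<tau> module_hom.add[of s "(*)" "\<lambda>x. \<tau> x u v" for u v]
      module_hom.scale[of s "(*)" "\<lambda>x. \<tau> x u v" for u v]
    by (simp_all add: trilin_def fun_eq_iff)
  show ?thesis
    using tensor_linear[OF \<delta>(2) trilin_slice(2)[OF \<tau>] trilin_slice(2)[OF \<tau>]]
      vector_space_mult \<delta>.m1.module_axioms
    by (simp add: bilin_def module_hom_def module_hom_axioms_def module_iff_vector_space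
        \<delta>.add \<delta>.scale fun_scale_def \<tau>x)
qed

lemma tensor_left_of_tensor_map:
  assumes \<delta>: "module_hom s fun_scale \<delta>" "\<And>x. \<delta> x \<in> tensor s s" and g: "module_hom s s g"
  shows "tensor_left s \<delta> (tensor_map s s f g T) =
    tensor3_map s id id g (tensor_left s (\<lambda>x. \<delta> (f x)) T)"
proof
  fix \<tau>
  show "tensor_left s \<delta> (tensor_map s s f g T) \<tau> =
    tensor3_map s id id g (tensor_left s (\<lambda>x. \<delta> (f x)) T) \<tau>"
  proof (cases "trilin s s s (*) \<tau>")
    case True
    then show ?thesis
      using module_hom_id[OF g] trilin_comp[OF True _ _ g, of id id] bilin_tensor_left[OF \<delta> True]
      by (simp add: tensor_left_def tensor3_map_def tensor_map_def)
  qed (simp add: tensor_left_def tensor3_map_def)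
qed

lemma tensor_right_of_tensor_map:
  assumes \<delta>: "module_hom s fun_scale \<delta>" "\<And>x. \<delta> x \<in> tensor s s" and f: "module_hom s s f"
  shows "tensor_right s \<delta> (tensor_map s s f g T) =
    tensor3_map s f id id (tensor_right s (\<lambda>x. \<delta> (g x)) T)"
proof
  fix \<tau>
  show "tensor_right s \<delta> (tensor_map s s f g T) \<tau> =
    tensor3_map s f id id (tensor_right s (\<lambda>x. \<delta> (g x)) T) \<tau>"
  proof (cases "trilin s s s (*) \<tau>")
    case True
    then show ?thesis
      using module_hom_id[OF f] trilin_comp[OF True f, of id id] bilin_tensor_right[OF \<delta> True]
      by (simp add: tensor_right_def tensor3_map_def tensor_map_def)
  qed (simp add: tensor_right_def tensor3_map_def)
qed

lemma tensor_left_add_comult: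
  assumes "module_hom s fun_scale \<delta>" "\<And>x. \<delta> x \<in> tensor s s"
    and "module_hom s fun_scale \<delta>'" "\<And>x. \<delta>' x \<in> tensor s s" and T: "T \<in> tensor s s"
  shows "tensor_left s (\<lambda>x. \<delta> x + \<delta>' x) T = tensor_left s \<delta> T + tensor_left s \<delta>' T"
  using tensor_linear(1)[OF T bilin_tensor_left[OF assms(1,2)] bilin_tensor_left[OF assms(3,4)]]
  by (auto simp: tensor_left_def fun_eq_iff)

lemma tensor_right_add_comult:
  assumes "module_hom s fun_scale \<delta>" "\<And>x. \<delta> x \<in> tensor s s"
    and "module_hom s fun_scale \<delta>'" "\<And>x. \<delta>' x \<in> tensor s s" and T: "T \<in> tensor s s"
  shows "tensor_right s (\<lambda>x. \<delta> x + \<delta>' x) T = tensor_right s \<delta> T + tensor_right s \<delta>' T"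
  using tensor_linear(1)[OF T bilin_tensor_right[OF assms(1,2)] bilin_tensor_right[OF assms(3,4)]]
  by (auto simp: tensor_right_def fun_eq_iff)

lemma tensor_left_scale_comult:
  assumes "module_hom s fun_scale \<delta>" "\<And>x. \<delta> x \<in> tensor s s" and T: "T \<in> tensor s s"
  shows "tensor_left s (\<lambda>x. fun_scale c (\<delta> x)) T = fun_scale c (tensor_left s \<delta> T)"
  using tensor_linear(2)[OF T bilin_tensor_left[OF assms(1,2)] bilin_tensor_left[OF assms(1,2)]]
  by (auto simp: tensor_left_def fun_scale_def fun_eq_iff)

lemma tensor_right_scale_comult:
  assumes "module_hom s fun_scale \<delta>" "\<And>x. \<delta> x \<in> tensor s s" and T: "T \<in> tensor s s"
  shows "tensor_right s (\<lambda>x. fun_scale c (\<delta> x)) T = fun_scale c (tensor_right s \<delta> T)"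
  using tensor_linear(2)[OF T bilin_tensor_right[OF assms(1,2)] bilin_tensor_right[OF assms(1,2)]]
  by (auto simp: tensor_right_def fun_scale_def fun_eq_iff)

lemma linear_tensor_left: "module_hom fun_scale fun_scale (tensor_left s \<delta>)"
  by (intro module_hom.intro module_hom_axioms.intro)
    (simp_all only: module_iff_vector_space vector_space_fun_scale,
      auto simp: tensor_left_def fun_scale_def fun_eq_iff)

lemma linear_tensor_right: "module_hom fun_scale fun_scale (tensor_right s \<delta>)"
  by (intro module_hom.intro module_hom_axioms.intro)
    (simp_all only: module_iff_vector_space vector_space_fun_scale,
      auto simp: tensor_right_def fun_scale_def fun_eq_iff)

context commuting_pairs
begin

abbreviation "TM3 \<equiv> tensor3_map s"

lemmas TM3_simps = tensor3_map_add tensor3_map_comp hom hom_id TM_id id_apply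

lemma TM3_id: "TM3 (\<lambda>x. x) = TM3 id" "TM3 f (\<lambda>x. x) = TM3 f id" "TM3 f g (\<lambda>x. x) = TM3 f g id"
  by (auto simp: id_def)

lemma coherent_comult_TM:
  assumes "coherent_comult \<delta>" "module_hom s s f" "module_hom s s g"
  shows "module_hom s fun_scale (\<lambda>x. TM f g (\<delta> x))" "TM f g (\<delta> x) \<in> tensor s s"
  using module_hom_compose[OF coherent_comultD(1)[OF assms(1)] linear_tensor_map]
    tensor_map_in_tensor[OF assms(2,3) coherent_comultD(2)[OF assms(1)]]
  by (simp_all add: o_def)

text \<open>
  Both sides of coassociativity satisfy the same differential equation, whose generator \<open>p\<^sub>1 \<otimes> p\<^sub>2
  \<otimes> id + p\<^sub>1 \<otimes> id \<otimes> p\<^sub>2 + id \<otimes> p\<^sub>1 \<otimes> p\<^sub>2\<close> does not depend on the bracketing. On either side two of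
  the three summands come from the coderivation property, applied to \<open>p\<^sub>1\<close> here and to \<open>p\<^sub>2\<close> in
  \<open>flow_tensor_right\<close>.
\<close>

lemma flow_tensor_left:
  assumes \<delta>: "coherent_comult \<delta>" and T: "T \<in> tensor s s"
  shows "tensor_left s \<delta> (TM p1 p2 T) + tensor_left s (\<lambda>x. TM p1 p2 (\<delta> x)) T =
    TM3 p1 p2 id (tensor_left s \<delta> T) + TM3 p1 id p2 (tensor_left s \<delta> T) +
      TM3 id p1 p2 (tensor_left s \<delta> T)"
proof -
  note c = coherent_comultD[OF \<delta>]
  have "tensor_left s \<delta> (TM p1 p2 T) =
      TM3 id id p2 (tensor_left s (\<lambda>x. TM p1 id (\<delta> x) + TM id p1 (\<delta> x)) T)"
    using tensor_left_of_tensor_map[OF c(1,2) hom(4)] by (simp only: c(3))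
  also have "tensor_left s (\<lambda>x. TM p1 id (\<delta> x) + TM id p1 (\<delta> x)) T =
      TM3 p1 id id (tensor_left s \<delta> T) + TM3 id p1 id (tensor_left s \<delta> T)"
    using tensor_left_add_comult[OF coherent_comult_TM[OF \<delta>] coherent_comult_TM[OF \<delta>] T]
      hom hom_id by (simp only: tensor_left_tensor_map)
  finally show ?thesis
    by (simp only: TM3_simps TM3_id tensor_left_tensor_map add_ac)
qed

lemma flow_tensor_right:
  assumes \<delta>: "coherent_comult \<delta>" and T: "T \<in> tensor s s"
  shows "tensor_right s \<delta> (TM p1 p2 T) + tensor_right s (\<lambda>x. TM p1 p2 (\<delta> x)) T =
    TM3 p1 p2 id (tensor_right s \<delta> T) + TM3 p1 id p2 (tensor_right s \<delta> T) +
      TM3 id p1 p2 (tensor_right s \<delta> T)"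
proof -
  note c = coherent_comultD[OF \<delta>]
  have "tensor_right s \<delta> (TM p1 p2 T) =
      TM3 p1 id id (tensor_right s (\<lambda>x. TM p2 id (\<delta> x) + TM id p2 (\<delta> x)) T)"
    using tensor_right_of_tensor_map[OF c(1,2) hom(3)] by (simp only: c(4))
  also have "tensor_right s (\<lambda>x. TM p2 id (\<delta> x) + TM id p2 (\<delta> x)) T =
      TM3 id p2 id (tensor_right s \<delta> T) + TM3 id id p2 (tensor_right s \<delta> T)"
    using tensor_right_add_comult[OF coherent_comult_TM[OF \<delta>] coherent_comult_TM[OF \<delta>] T]
      hom hom_id by (simp only: tensor_right_tensor_map)
  finally show ?thesis
    by (simp only: TM3_simps TM3_id tensor_right_tensor_map add_ac)
qed

end

section \<open>Flows of coherent structures\<close>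

text \<open>
  Regrouping of sums in which every term of a condition is paired with its product rule partner.
\<close>

lemma add_differences:
  fixes a :: "'b::ab_group_add"
  assumes "a + a' = u" "b + b' = v" "c + c' = w"
  shows "(a - (b + c)) + (a' - (b' + c')) = u - (v + w)"
  unfolding assms[symmetric] by (simp add: algebra_simps)

lemma add_flipped_differences:
  fixes a :: "('k::ab_group_add, 'v, 'w) tens"
  assumes "a + a' = t" "b + b' = u" "c + c' = v" "d + d' = w"
  shows "((a - b) + tensor_flip (c - d)) + ((a' - b') + tensor_flip (c' - d')) =
    (t - u) + tensor_flip (v - w)"
  unfolding assms[symmetric] add_diff_add tensor_flip_add by (simp only: add_ac)

text \<open>
  Coefficients of a multiplication and a comultiplication over power series, subject to the
  differential equations \<open>\<mu>' = \<mu> (d\<^sub>1 \<otimes> d\<^sub>2)\<close> and \<open>\<delta>' = (p\<^sub>1 \<otimes> p\<^sub>2) \<delta>\<close>. The equations determine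
  all coefficients from those at \<open>0\<close>; stating them instead of the closed form keeps powers and
  factorials out of the arguments below.
\<close>

locale coherent_flow = commuting_pairs s d1 d2 p1 p2
  for s :: "'k::field_char_0 \<Rightarrow> 'a::ab_group_add \<Rightarrow> 'a" and d1 d2 p1 p2 :: "'a \<Rightarrow> 'a" +
  fixes M :: "nat \<Rightarrow> 'a \<Rightarrow> 'a \<Rightarrow> 'a" and C :: "nat \<Rightarrow> 'a \<Rightarrow> ('k, 'a, 'a) tens"
  assumes coherent_M: "coherent_mult (M j)"
    and coherent_C: "coherent_comult (C i)"
    and M_Suc: "s (of_nat (Suc j)) (M (Suc j) x y) = M j (d1 x) (d2 y)"
    and C_Suc: "fun_scale (of_nat (Suc i)) (C (Suc i) x) = TM p1 p2 (C i x)"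
begin

lemmas M_hom = coherent_multD(1,2)[OF coherent_M]
lemmas C_hom = coherent_comultD(1)[OF coherent_C]
lemmas C_tensor = coherent_comultD(2)[OF coherent_C]

lemmas C_scale = module_hom.scale[OF C_hom]

lemma TM_M_Suc:
  "fun_scale (of_nat (Suc j)) (TM (M (Suc j) x) id (C i z)) = TM (\<lambda>y. M j (d1 x) (d2 y)) id (C i z)"
  "fun_scale (of_nat (Suc j)) (TM id (M (Suc j) x) (C i z)) = TM id (\<lambda>y. M j (d1 x) (d2 y)) (C i z)"
  "fun_scale (of_nat (Suc j)) (TM (\<lambda>x. M (Suc j) x y) id (C i z)) =
    TM (\<lambda>x. M j (d1 x) (d2 y)) id (C i z)"
  "fun_scale (of_nat (Suc j)) (TM id (\<lambda>x. M (Suc j) x y) (C i z)) =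
    TM id (\<lambda>x. M j (d1 x) (d2 y)) (C i z)"
  by (simp_all only: M_Suc
      tensor_map_scale_left[OF M_hom(1) hom_id(1) C_tensor, symmetric]
      tensor_map_scale_left[OF M_hom(2) hom_id(1) C_tensor, symmetric]
      tensor_map_scale_right[OF hom_id(1) M_hom(1) C_tensor, symmetric]
      tensor_map_scale_right[OF hom_id(1) M_hom(2) C_tensor, symmetric])

lemma TM_C_Suc:
  "fun_scale (of_nat (Suc i)) (TM f g (C (Suc i) x)) = TM f g (TM p1 p2 (C i x))"
  by (simp only: C_Suc flip: tensor_map_scale)

sublocale tens: vector_space "fun_scale :: 'k \<Rightarrow> ('k, 'a, 'a) tens \<Rightarrow> _"
  by (rule vector_space_fun_scale)

sublocale tens3: vector_space "fun_scale :: 'k \<Rightarrow> ('k, 'a, 'a, 'a) tens3 \<Rightarrow> _"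
  by (rule vector_space_fun_scale)

text \<open>
  In this theorem and the next three, \<open>e\<close> collects the defect of an axiom, and \<open>\<Lambda>\<close> is the operator
  that the identities for the single terms produce for it. Here the Leibniz rule for \<open>d\<^sub>1\<close> and
  \<open>d\<^sub>2\<close> gives the generator \<open>d\<^sub>1 \<otimes> d\<^sub>2 \<otimes> id + d\<^sub>1 \<otimes> id \<otimes> d\<^sub>2 + id \<otimes> d\<^sub>1 \<otimes> d\<^sub>2\<close>.
\<close>

theorem M_assoc:
  assumes "\<And>x y z. M 0 (M 0 x y) z = M 0 x (M 0 y z)"
  shows "(\<Sum>i\<le>n. M (n - i) (M i x y) z) = (\<Sum>i\<le>n. M (n - i) x (M i y z))"
proof -
  define e where "e i j = (\<lambda>(x, y, z). M j (M i x y) z - M j x (M i y z))" for i j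
  define \<Lambda> where "\<Lambda> f = (\<lambda>(x, y, z). f (d1 x, d2 y, z) + f (d1 x, y, d2 z) + f (x, d1 y, d2 z))"
    for f :: "'a \<times> 'a \<times> 'a \<Rightarrow> 'a"
  have "(\<Sum>i\<le>n. e i (n - i) (x, y, z)) = 0"
  proof (rule Cauchy_product_flow_zero[where e = e and \<Lambda> = \<Lambda>, OF vector_space_axioms])
    fix i j and w :: "'a \<times> 'a \<times> 'a"
    obtain x y z where w: "w = (x, y, z)" by (metis prod_cases3)
    have "s (of_nat (Suc i)) (M j (M (Suc i) x y) z) = M j (M i (d1 x) (d2 y)) z" for x y z
      by (subst M_hom(2)[THEN module_hom.scale, symmetric]) (simp only: M_Suc)
    moreover have "s (of_nat (Suc i)) (M j x (M (Suc i) y z)) = M j x (M i (d1 y) (d2 z))" for x y z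
      by (subst M_hom(1)[THEN module_hom.scale, symmetric]) (simp only: M_Suc)
    ultimately show "s (of_nat (Suc i)) (e (Suc i) j w) + s (of_nat (Suc j)) (e i (Suc j) w) =
      \<Lambda> (e i j) w"
      by (simp add: w e_def \<Lambda>_def scale_right_diff_distrib M_Suc M_hom[THEN module_hom.add]
          coherent_multD(3,4)[OF coherent_M] del: of_nat_Suc)
  qed (auto simp: \<Lambda>_def fun_eq_iff e_def assms)
  then show ?thesis
    by (simp add: e_def sum_subtractf)
qed

theorem C_coassoc:
  assumes "\<And>x. tensor_left s (C 0) (C 0 x) = tensor_right s (C 0) (C 0 x)"
  shows "(\<Sum>i\<le>n. tensor_left s (C (n - i)) (C i x)) = (\<Sum>i\<le>n. tensor_right s (C (n - i)) (C i x))"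
proof -
  define e where "e i j x = tensor_left s (C j) (C i x) - tensor_right s (C j) (C i x)" for i j x
  define \<Lambda> where "\<Lambda> f x = TM3 p1 p2 id (f x) + TM3 p1 id p2 (f x) + TM3 id p1 p2 (f x)"
    for f :: "'a \<Rightarrow> ('k, 'a, 'a, 'a) tens3" and x
  have "(\<Sum>i\<le>n. e i (n - i) x) = 0"
  proof (rule Cauchy_product_flow_zero[where e = e and \<Lambda> = \<Lambda>, OF vector_space_fun_scale])
    fix i j x
    have 1: "fun_scale (of_nat (Suc i)) (tensor_left s (C j) (C (Suc i) x)) =
      tensor_left s (C j) (TM p1 p2 (C i x))"
      "fun_scale (of_nat (Suc i)) (tensor_right s (C j) (C (Suc i) x)) =
        tensor_right s (C j) (TM p1 p2 (C i x))"
      by (simp_all only: C_Suc flip: linear_tensor_left[THEN module_hom.scale]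
        linear_tensor_right[THEN module_hom.scale])
    have 2: "fun_scale (of_nat (Suc j)) (tensor_left s (C (Suc j)) (C i x)) =
      tensor_left s (\<lambda>x. TM p1 p2 (C j x)) (C i x)"
      "fun_scale (of_nat (Suc j)) (tensor_right s (C (Suc j)) (C i x)) =
        tensor_right s (\<lambda>x. TM p1 p2 (C j x)) (C i x)"
      by (simp_all only: C_Suc flip: tensor_left_scale_comult[OF C_hom C_tensor C_tensor]
          tensor_right_scale_comult[OF C_hom C_tensor C_tensor])
    show "fun_scale (of_nat (Suc i)) (e (Suc i) j x) + fun_scale (of_nat (Suc j)) (e i (Suc j) x) =
      \<Lambda> (e i j) x"
      unfolding e_def \<Lambda>_def tens3.scale_right_diff_distrib 1 2 tensor3_map_diff
        add_diff_add[symmetric] flow_tensor_left[OF coherent_C C_tensor] flow_tensor_right[OF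
          coherent_C C_tensor] ..
  next
    fix f g :: "'a \<Rightarrow> ('k, 'a, 'a, 'a) tens3"
    show "\<Lambda> (\<lambda>z. f z + g z) = (\<lambda>z. \<Lambda> f z + \<Lambda> g z)"
      by (intro ext) (simp only: \<Lambda>_def tensor3_map_add add_ac)
  qed (simp only: e_def assms diff_self)
  then show ?thesis
    by (simp only: e_def sum_subtractf right_minus_eq)
qed

theorem C_M_derivation:
  assumes "\<And>x y. C 0 (M 0 x y) = TM id (M 0 x) (C 0 y) + TM (\<lambda>z. M 0 z y) id (C 0 x)"
  shows "(\<Sum>i\<le>n. C i (M (n - i) x y)) =
    (\<Sum>i\<le>n. TM id (M (n - i) x) (C i y)) + (\<Sum>i\<le>n. TM (\<lambda>z. M (n - i) z y) id (C i x))"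
proof -
  define e where "e i j = (\<lambda>(x, y). C i (M j x y) - (TM id (M j x) (C i y) +
    TM (\<lambda>z. M j z y) id (C i x)))" for i j
  define \<Lambda> where "\<Lambda> f = (\<lambda>(x, y). TM id p1 (f (d2 x, y) + f (x, d2 y)) + f (d1 x, d2 y))"
    for f :: "'a \<times> 'a \<Rightarrow> ('k, 'a, 'a) tens"
  have "(\<Sum>i\<le>n. e i (n - i) (x, y)) = 0"
  proof (rule Cauchy_product_flow_zero[where e = e and \<Lambda> = \<Lambda>, OF vector_space_fun_scale])
    fix i j and w :: "'a \<times> 'a"
    obtain x y where w: "w = (x, y)" by (rule prod.exhaust)
    have 1: "fun_scale (of_nat (Suc j)) (C i (M (Suc j) x y)) = C i (M j (d1 x) (d2 y))"
      by (simp only: M_Suc flip: C_scale)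
    note * = coherent_M[of j] coherent_C[of i]
    show "fun_scale (of_nat (Suc i)) (e (Suc i) j w) + fun_scale (of_nat (Suc j)) (e i (Suc j) w) =
      \<Lambda> (e i j) w"
      unfolding w e_def \<Lambda>_def prod.case tens.scale_right_diff_distrib tens.scale_right_distrib
        1 C_Suc TM_C_Suc TM_M_Suc
        add_differences[OF flow_comult_of_mult[OF *] flow_left_mult_right_factor[OF *]
          flow_right_mult_left_factor[OF *]]
      by (simp only: tensor_map_diff tensor_map_add algebra_simps)
  next
    fix f g :: "'a \<times> 'a \<Rightarrow> ('k, 'a, 'a) tens"
    show "\<Lambda> (\<lambda>z. f z + g z) = (\<lambda>z. \<Lambda> f z + \<Lambda> g z)"
      by (intro ext) (simp only: \<Lambda>_def tensor_map_add add_ac split_beta)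
  next
    fix z show "e 0 0 z = 0"
      by (simp only: e_def assms diff_self split_beta)
  qed
  then show ?thesis
    by (simp only: e_def prod.case sum_subtractf sum.distrib right_minus_eq)
qed

theorem C_M_antisymmetry:
  assumes "\<And>x y. (TM (M 0 y) id (C 0 x) - TM id (\<lambda>z. M 0 z y) (C 0 x)) +
    tensor_flip (TM (M 0 x) id (C 0 y) - TM id (\<lambda>z. M 0 z x) (C 0 y)) = 0"
  shows "(\<Sum>i\<le>n. (TM (M (n - i) y) id (C i x) - TM id (\<lambda>z. M (n - i) z y) (C i x)) +
    tensor_flip (TM (M (n - i) x) id (C i y) - TM id (\<lambda>z. M (n - i) z x) (C i y))) = 0"
proof -
  define e where "e i j = (\<lambda>(x, y). (TM (M j y) id (C i x) - TM id (\<lambda>z. M j z y) (C i x)) +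
    tensor_flip (TM (M j x) id (C i y) - TM id (\<lambda>z. M j z x) (C i y)))" for i j
  define \<Lambda> where "\<Lambda> f = (\<lambda>(x, y). TM id p1 (f (d2 x, y)) + TM id p2 (f (x, d1 y)) + f (d2 x, d1 y))"
    for f :: "'a \<times> 'a \<Rightarrow> ('k, 'a, 'a) tens"
  have "(\<Sum>i\<le>n. e i (n - i) (x, y)) = 0"
  proof (rule Cauchy_product_flow_zero[where e = e and \<Lambda> = \<Lambda>, OF vector_space_fun_scale])
    fix i j and w :: "'a \<times> 'a"
    obtain x y where w: "w = (x, y)" by (rule prod.exhaust)
    note * = coherent_M[of j] coherent_C[of i]
    show "fun_scale (of_nat (Suc i)) (e (Suc i) j w) + fun_scale (of_nat (Suc j)) (e i (Suc j) w) =
      \<Lambda> (e i j) w"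
      unfolding w e_def \<Lambda>_def prod.case tens.scale_right_diff_distrib tens.scale_right_distrib
        tensor_flip_scale[symmetric] TM_C_Suc TM_M_Suc
        add_flipped_differences[OF flow_left_mult_left_factor[OF *] flow_right_mult_right_factor[OF
          *]
          flow_flipped_left_mult_left_factor[OF *] flow_flipped_right_mult_right_factor[OF *]]
      by (simp only: tensor_map_flip tensor_flip_add tensor_flip_diff tensor_map_diff tensor_map_add
        algebra_simps)
  next
    fix f g :: "'a \<times> 'a \<Rightarrow> ('k, 'a, 'a) tens"
    show "\<Lambda> (\<lambda>z. f z + g z) = (\<lambda>z. \<Lambda> f z + \<Lambda> g z)"
      by (intro ext) (simp only: \<Lambda>_def tensor_map_add add_ac split_beta)
  next
    fix z show "e 0 0 z = 0"
      by (simp only: e_def assms split_beta)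
  qed
  then show ?thesis
    by (simp only: e_def prod.case)
qed

end

section \<open>Series of linear and bilinear maps\<close>

lemma triangle_sum_shift:
  fixes f :: "nat \<Rightarrow> nat \<Rightarrow> nat \<Rightarrow> 'b::comm_monoid_add"
  shows "(\<Sum>k\<le>n. \<Sum>i\<le>k. f i (k - i) (n - k)) = (\<Sum>i\<le>n. \<Sum>j\<le>n - i. f i j (n - i - j))"
  using fps_mult_assoc_lemma[of f n n] by (simp only: atLeast0AtMost)

lemma triangle_sum_swap:
  fixes f :: "nat \<Rightarrow> nat \<Rightarrow> 'b::comm_monoid_add"
  shows "(\<Sum>i\<le>n. \<Sum>j\<le>n - i. f i j) = (\<Sum>j\<le>n. \<Sum>i\<le>n - j. f i j)"
  unfolding sum.Sigma[OF finite_atMost ballI[OF finite_atMost]]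
  by (rule sum.reindex_bij_witness[where i = "\<lambda>(j, i). (i, j)" and j = "\<lambda>(i, j). (j, i)"]) auto

lemma sum_atMost_reverse:
  fixes f :: "nat \<Rightarrow> 'b::comm_monoid_add"
  shows "(\<Sum>i\<le>n. f (n - i)) = (\<Sum>i\<le>n. f i)"
  by (rule sum.reindex_bij_witness[where i = "\<lambda>i. n - i" and j = "\<lambda>i. n - i"]) auto

text \<open>
  Multiplication by a power series is itself the extension of its coefficients, so that the module
  axioms and linearity over the power series ring become cases of the composition law \<open>hext_hext\<close>.
\<close>

lemma hscale_eq_hext: "hscale s c = hext (\<lambda>r. s (fps_nth c r))"
proof (intro ext)
  fix X n
  show "hscale s c X n = hext (\<lambda>r. s (fps_nth c r)) X n"
    using sum_atMost_reverse[of "\<lambda>i. s (fps_nth c i) (X (n - i))" n]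
    by (simp add: hscale_def hext_def)
qed

lemma hext_hext:
  assumes F: "\<And>r. module_hom s s' (F r)"
  shows "hext F (hext G X) = hext (\<lambda>n x. \<Sum>i\<le>n. F (n - i) (G i x)) X"
proof
  fix n
  show "hext F (hext G X) n = hext (\<lambda>n x. \<Sum>i\<le>n. F (n - i) (G i x)) X n"
    using triangle_sum_shift[of "\<lambda>a b c. F c (G b (X a))" n]
    by (simp only: hext_def module_hom.sum[OF F])
qed

lemma hext_add:
  assumes F: "\<And>r. module_hom s s' (F r)"
  shows "hext F (X + Y) = hext F X + hext F Y"
  by (rule ext) (simp add: hext_def module_hom.add[OF F] sum.distrib)

lemma module_hscale:
  assumes "module s"
  shows "module (hscale s)"
proof -
  interpret module s by fact
  have hom: "module_hom s s (s c)" for c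
    by unfold_locales (simp_all add: scale_right_distrib mult.commute)
  show ?thesis
  proof
    fix a b :: "'a fps" and X Y :: "nat \<Rightarrow> 'b"
    show "hscale s a (X + Y) = hscale s a X + hscale s a Y"
      unfolding hscale_eq_hext by (rule hext_add) (rule hom)
    show "hscale s (a + b) X = hscale s a X + hscale s b X"
      by (rule ext) (simp add: hscale_def scale_left_distrib sum.distrib)
    show "hscale s a (hscale s b X) = hscale s (a * b) X"
    proof -
      have "(\<Sum>i\<le>n. s (fps_nth a (n - i)) (s (fps_nth b i) x)) = s (fps_nth (a * b) n) x" for n x
        using sum_atMost_reverse[of "\<lambda>i. fps_nth a i * fps_nth b (n - i)" n]
        by (simp add: fps_mult_nth atLeast0AtMost flip: scale_sum_left)
      then show ?thesis
        unfolding hscale_eq_hext hext_hext[OF hom] by simp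
    qed
    show "hscale s 1 X = X"
      using hscale_X_power[OF assms, of 0] by (simp add: fun_eq_iff)
  qed
qed

lemma module_hom_hext:
  assumes F: "\<And>r. module_hom s s' (F r)"
  shows "module_hom (hscale s) (hscale s') (hext F)"
proof -
  interpret F: module_hom s s' "F r" for r by fact
  have hom: "module_hom s' s' (s' c)" for c
    by unfold_locales (simp_all add: F.m2.scale_right_distrib mult.commute)
  have "hext F (hscale s c X) = hscale s' c (hext F X)" for c X
  proof -
    have "(\<Sum>i\<le>n. F (n - i) (s (fps_nth c i) x)) = (\<Sum>i\<le>n. s' (fps_nth c (n - i)) (F i x))" for n x
      using sum_atMost_reverse[of "\<lambda>i. F i (s (fps_nth c (n - i)) x)" n] by (simp add: F.scale)
    then show ?thesis
      unfolding hscale_eq_hext hext_hext[OF F] hext_hext[OF hom] by simp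
  qed
  then show ?thesis
    by (intro module_hom.intro module_hom_axioms.intro module_hscale F.m1.module_axioms
      F.m2.module_axioms hext_add[OF F])
qed

lemma hext_hconst:
  assumes F: "\<And>r. module_hom s s' (F r)"
  shows "hext F (hconst x) = (\<lambda>n. F n x)"
proof
  fix n
  have "(\<Sum>i\<le>n. F (n - i) (hconst x i)) = (\<Sum>i\<le>n. if i = 0 then F n x else 0)"
    by (rule sum.cong) (auto simp: hconst_def module_hom.zero[OF F])
  then show "hext F (hconst x) n = F n x" by (simp add: hext_def)
qed

lemma hcoeff_hext:
  assumes F: "\<And>r. module_hom s s' (F r)"
  shows "hcoeff (hext F) = F"
  by (intro ext) (simp add: hcoeff_def hext_hconst[OF F])

text \<open>
  Linear maps over the power series ring are \<open>h\<close>-adically continuous, hence determined by their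
  values on constant series.
\<close>

lemma module_hom_eq_on_hconst:
  assumes "module_hom (hscale s) (hscale s') F" "module_hom (hscale s) (hscale s') G"
    and "module s" "module s'" and "\<And>x. F (hconst x) = G (hconst x)"
  shows "F X = G X"
  using hext_hcoeff[OF assms(1,3,4), of X] hext_hcoeff[OF assms(2,3,4), of X]
  by (simp add: hcoeff_def[abs_def] assms(5))

lemma hext2_eq_hext: "hext2 B X = hext (\<lambda>r y. \<Sum>i\<le>r. B (r - i) (X i) y)"
proof (intro ext)
  fix Y n
  have "hext2 B X Y n = (\<Sum>j\<le>n. \<Sum>i\<le>n - j. B (n - i - j) (X i) (Y j))"
    unfolding hext2_def by (rule triangle_sum_swap)
  also have "\<dots> = (\<Sum>j\<le>n. \<Sum>i\<le>n - j. B (n - j - i) (X i) (Y j))"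
    by (intro sum.cong refl) (simp add: add.commute)
  finally show "hext2 B X Y n = hext (\<lambda>r y. \<Sum>i\<le>r. B (r - i) (X i) y) Y n"
    by (simp only: hext_def)
qed

lemma hext2_commute: "hext2 B X Y = hext2 (\<lambda>r x y. B r y x) Y X"
  unfolding hext2_eq_hext[of B] by (rule ext) (simp only: hext_def hext2_def)

lemma module_hom_sum:
  assumes "\<And>i. module_hom s s' (f i)"
  shows "module_hom s s' (\<lambda>x. \<Sum>i\<in>I. f i x)"
proof -
  interpret f: module_hom s s' "f i" for i by fact
  show ?thesis
    by unfold_locales (simp_all add: f.add f.scale sum.distrib f.m2.scale_sum_right)
qed

lemma bilin_hext2:
  assumes B: "\<And>r. bilin sU sV sW (B r)"
  shows "bilin (hscale sU) (hscale sV) (hscale sW) (hext2 B)"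
proof -
  have "module_hom (hscale sV) (hscale sW) (hext2 B X)" for X
    unfolding hext2_eq_hext using B by (intro module_hom_hext module_hom_sum) (simp add: bilin_def)
  moreover have "module_hom (hscale sU) (hscale sW) (\<lambda>X. hext2 B X Y)" for Y
    unfolding hext2_commute[of B _ Y] hext2_eq_hext[of "\<lambda>r x y. B r y x"]
    using B by (intro module_hom_hext module_hom_sum) (simp add: bilin_def)
  ultimately show ?thesis by (simp add: bilin_def)
qed

lemma hext2_hconst_left:
  assumes B: "\<And>r. bilin sU sV sW (B r)"
  shows "hext2 B (hconst x) = hext (\<lambda>r. B r x)"
proof -
  have "(\<Sum>i\<le>r. B (r - i) (hconst x i) y) = B r x y" for r y
    using fun_cong[OF hext_hconst[of sU sW "\<lambda>r x. B r x y" x], of r] B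
    by (simp add: hext_def bilin_def)
  then show ?thesis by (simp add: hext2_eq_hext)
qed

lemma hext2_hconst_right:
  assumes B: "\<And>r. bilin sU sV sW (B r)"
  shows "hext2 B X (hconst y) = hext (\<lambda>r x. B r x y) X"
  by (subst hext2_commute, subst hext2_hconst_left[of sV sU sW]) (use B in \<open>auto simp: bilin_def\<close>)

lemma hext2_add:
  "hext2 (\<lambda>r x y. B r x y + B' r x y) X Y = hext2 B X Y + hext2 B' X Y"
  by (rule ext) (simp add: hext2_def sum.distrib)

lemma hext2_diff:
  fixes B :: "nat \<Rightarrow> 'u \<Rightarrow> 'v \<Rightarrow> 'w::ab_group_add"
  shows "hext2 (\<lambda>r x y. B r x y - B' r x y) X Y = hext2 B X Y - hext2 B' X Y"
  by (rule ext) (simp add: hext2_def sum_subtractf)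

lemma hext2_zero: "hext2 (\<lambda>r x y. 0) X Y = 0"
  by (rule ext) (simp add: hext2_def)

lemma hext_hext2:
  assumes F: "\<And>r. module_hom s s' (F r)"
  shows "hext F (hext2 B X Y) = hext2 (\<lambda>n x y. \<Sum>i\<le>n. F (n - i) (B i x y)) X Y"
proof -
  have "(\<Sum>k\<le>n. F (n - k) (\<Sum>i\<le>k. B (k - i) (X i) y)) =
      (\<Sum>a\<le>n. \<Sum>i\<le>n - a. F (n - a - i) (B i (X a) y))" for n y
    using triangle_sum_shift[of "\<lambda>a b c. F c (B b (X a) y)" n]
    by (simp only: module_hom.sum[OF F])
  then show ?thesis
    by (simp only: hext2_eq_hext hext_hext[OF F])
qed

lemma eq_mod_hI:
  assumes "module s" "X 0 = Y 0" "\<And>n. X (Suc n) - Y (Suc n) \<in> S"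
  shows "eq_mod_h s S X Y"
  unfolding eq_mod_h_def
proof (rule image_eqI)
  show "X - Y = hscale s fps_X (\<lambda>n. X (Suc n) - Y (Suc n))"
    using hscale_X_power[OF assms(1), of 1 "\<lambda>n. X (Suc n) - Y (Suc n)"] assms(2)
    by (auto simp: fun_eq_iff)
  show "(\<lambda>n. X (Suc n) - Y (Suc n)) \<in> hseries S"
    using assms(3) by (simp add: hseries_def)
qed

section \<open>Series of maps on tensors\<close>

text \<open>
  The identity on series has vanishing higher coefficients. A zero map in one slot kills a tensor,
  so only one summand of the Cauchy product in \<open>htensor_map\<close> survives when one factor is the
  identity.
\<close>

lemma tensor_map_zero_left:
  assumes "T \<in> tensor sV sW" "module sV" "module sW"
  shows "tensor_map sV' sW' (\<lambda>x. 0) g T = 0"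
proof
  fix \<beta>
  have "T (\<lambda>x y. 0) = 0"
    using tensor_linear(2)[OF assms(1), of "\<lambda>x y. 0" "\<lambda>x y. 0" 0] assms(2,3)
    by (simp add: bilin_def module_hom_def module_hom_axioms_def module_iff_vector_space
      vector_space_mult)
  moreover have "\<beta> 0 y = 0" if "bilin sV' sW' (*) \<beta>" for y
    using that module_hom.zero[of sV' "(*)" "\<lambda>x. \<beta> x y"] by (simp add: bilin_def)
  ultimately show "tensor_map sV' sW' (\<lambda>x. 0) g T \<beta> = 0 \<beta>"
    by (simp add: tensor_map_def)
qed

lemma tensor_map_zero_right:
  assumes "T \<in> tensor sV sW" "module sV" "module sW"
  shows "tensor_map sV' sW' f (\<lambda>x. 0) T = 0"
proof
  fix \<beta>
  have "T (\<lambda>x y. 0) = 0"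
    using tensor_linear(2)[OF assms(1), of "\<lambda>x y. 0" "\<lambda>x y. 0" 0] assms(2,3)
    by (simp add: bilin_def module_hom_def module_hom_axioms_def module_iff_vector_space
      vector_space_mult)
  moreover have "\<beta> x 0 = 0" if "bilin sV' sW' (*) \<beta>" for x
    using that module_hom.zero[of sW' "(*)" "\<beta> x"] by (simp add: bilin_def)
  ultimately show "tensor_map sV' sW' f (\<lambda>x. 0) T \<beta> = 0 \<beta>"
    by (simp add: tensor_map_def)
qed

lemma tensor_map_id:
  fixes sV :: "'k::field \<Rightarrow> 'v::ab_group_add \<Rightarrow> 'v" and sW :: "'k \<Rightarrow> 'w::ab_group_add \<Rightarrow> 'w"
  assumes "T \<in> tensor sV sW"
  shows "tensor_map sV sW id id T = T"
proof -
  interpret vector_space "fun_scale :: 'k \<Rightarrow> ('k, 'v, 'w) tens \<Rightarrow> _" by (rule vector_space_fun_scale)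
  show ?thesis
    using assms unfolding tensor_def
  proof (induction rule: span_induct_alt)
    case base
    show ?case by (rule tensor_map_zero)
  next
    case (step c P T)
    then have "tensor_map sV sW id id P = P"
      by (auto simp: tensor_map_def pure_def fun_eq_iff)
    with step show ?case by (simp only: tensor_map_add tensor_map_scale)
  qed
qed

lemma hcoeff_id: "hcoeff id i = (if i = 0 then id else (\<lambda>x. 0))"
  by (auto simp: hcoeff_def hconst_def fun_eq_iff)

lemma htensor_map_id_left:
  assumes G: "\<And>r. module_hom s s (G r)" and T: "\<And>n. T n \<in> tensor s s"
  shows "htensor_map s s id (hext G) T = hext (\<lambda>r. tensor_map s s id (G r)) T"
proof -
  have m: "module s" using G by (simp add: module_hom_def)
  have "(\<Sum>i\<le>r. tensor_map s s (hcoeff id i) (G (r - i)) (T n)) =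
      tensor_map s s id (G r) (T n)" for r n
  proof -
    have "(\<Sum>i\<le>r. tensor_map s s (hcoeff id i) (G (r - i)) (T n)) =
        (\<Sum>i\<le>r. if i = 0 then tensor_map s s id (G r) (T n) else 0)"
      by (rule sum.cong) (auto simp: hcoeff_id tensor_map_zero_left[OF T m m])
    then show ?thesis by simp
  qed
  then show ?thesis
    by (intro ext) (simp only: htensor_map_def hext_def hcoeff_hext[OF G])
qed

lemma htensor_map_id_right:
  assumes F: "\<And>r. module_hom s s (F r)" and T: "\<And>n. T n \<in> tensor s s"
  shows "htensor_map s s (hext F) id T = hext (\<lambda>r. tensor_map s s (F r) id) T"
proof -
  have m: "module s" using F by (simp add: module_hom_def)
  have "(\<Sum>i\<le>r. tensor_map s s (F i) (hcoeff id (r - i)) (T n)) =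
      tensor_map s s (F r) id (T n)" for r n
  proof -
    have "(\<Sum>i\<le>r. tensor_map s s (F i) (hcoeff id (r - i)) (T n)) =
        (\<Sum>i\<le>r. if i = r then tensor_map s s (F r) id (T n) else 0)"
      by (rule sum.cong) (auto simp: hcoeff_id tensor_map_zero_right[OF T m m])
    then show ?thesis by simp
  qed
  then show ?thesis
    by (intro ext) (simp only: htensor_map_def hext_def hcoeff_hext[OF F])
qed

section \<open>Deformations from flows\<close>

context commuting_pairs
begin

text \<open>
  The coefficients of \<open>exp (h (d\<^sub>1 \<otimes> d\<^sub>2))\<close> and \<open>exp (h (p\<^sub>1 \<otimes> p\<^sub>2))\<close> solve the two differential
  equations, and they stay coherent because each is a multiple of an iterated step.
\<close>

lemma coherent_flow_exponential:
  assumes m: "coherent_mult m" and D: "coherent_comult D"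
  shows "coherent_flow s d1 d2 p1 p2
    (\<lambda>r x y. s (1 / fact r) (m ((d1 ^^ r) x) ((d2 ^^ r) y)))
    (\<lambda>r x. fun_scale (1 / fact r) (TM (p1 ^^ r) (p2 ^^ r) (D x)))"
proof -
  interpret tens: vector_space "fun_scale :: 'k \<Rightarrow> ('k, 'a, 'a) tens \<Rightarrow> _"
    by (rule vector_space_fun_scale)
  have fact_Suc_quotient: "of_nat (Suc r) * (1 / fact (Suc r)) = (1 / fact r :: 'k)" for r
    by (simp add: field_simps del: of_nat_Suc)
  have "coherent_mult (\<lambda>x y. m ((d1 ^^ r) x) ((d2 ^^ r) y))" for r
  proof (induction r)
    case (Suc r)
    show ?case
      using coherent_mult_step[OF Suc] by (simp only: funpow_Suc_right o_apply)
  qed (use m in simp)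
  then have 1: "coherent_mult (\<lambda>x y. s (1 / fact r) (m ((d1 ^^ r) x) ((d2 ^^ r) y)))" for r
    by (rule coherent_mult_scale)
  have TM_Suc: "TM (p1 ^^ Suc r) (p2 ^^ Suc r) (D x) =
    TM p1 p2 (TM (p1 ^^ r) (p2 ^^ r) (D x))" for r x
    using hom by (simp add: TM_comp o_def)
  have "coherent_comult (\<lambda>x. TM (p1 ^^ r) (p2 ^^ r) (D x))" for r
  proof (induction r)
    case 0
    then show ?case
      using D by (simp add: tensor_map_id[OF coherent_comultD(2)[OF D], unfolded id_def] id_def)
  next
    case (Suc r)
    show ?case
      using coherent_comult_step[OF Suc] by (simp only: TM_Suc)
  qed
  then have 2: "coherent_comult (\<lambda>x. fun_scale (1 / fact r) (TM (p1 ^^ r) (p2 ^^ r) (D x)))" for r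
    by (rule coherent_comult_scale)
  show ?thesis
  proof (intro coherent_flow.intro coherent_flow_axioms.intro 1 2)
    show "commuting_pairs s d1 d2 p1 p2" by (rule commuting_pairs_axioms)
    show "s (of_nat (Suc j)) (s (1 / fact (Suc j)) (m ((d1 ^^ Suc j) x) ((d2 ^^ Suc j) y))) =
        s (1 / fact j) (m ((d1 ^^ j) (d1 x)) ((d2 ^^ j) (d2 y)))" for j x y
      by (simp only: scale_scale fact_Suc_quotient funpow_Suc_right o_apply)
    show "fun_scale (of_nat (Suc i)) (fun_scale (1 / fact (Suc i)) (TM (p1 ^^ Suc i) (p2 ^^ Suc i)
      (D x))) =
        TM p1 p2 (fun_scale (1 / fact i) (TM (p1 ^^ i) (p2 ^^ i) (D x)))" for i x
      by (simp only: tens.scale_scale fact_Suc_quotient TM_Suc tensor_map_scale)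
  qed
qed

end

context coherent_flow
begin

lemma bilin_M: "bilin s s s (M j)"
  using coherent_M[of j] by (simp add: coherent_mult_def)

lemma hext_C_tensor: "hext C X n \<in> tensor s s"
  unfolding hext_def using C_tensor unfolding tensor_def by (intro tens.span_sum)

text \<open>Both tensor slots are covered by one argument: \<open>K f\<close> stands for \<open>id \<otimes> f\<close> or \<open>f \<otimes> id\<close>.\<close>

lemma hext_bilinear_action:
  assumes A: "\<And>r x. module_hom s s (A r x)"
    and K_hom: "\<And>f. module_hom fun_scale fun_scale (K f)"
    and K_add: "\<And>f g T. module_hom s s f \<Longrightarrow> module_hom s s g \<Longrightarrow> T \<in> tensor s s \<Longrightarrow>
      K (\<lambda>x. f x + g x) T = K f T + K g T"
  shows "hext (\<lambda>r. K (\<lambda>y. \<Sum>i\<le>r. A (r - i) (X i) y)) (hext C Y) =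
    hext2 (\<lambda>n x y. \<Sum>l\<le>n. K (A (n - l) x) (C l y)) X Y"
proof -
  have zero: "module_hom s s (\<lambda>x. 0)"
    using module_hom_sum[of s s "\<lambda>i::nat. id" "{}"] hom_id by simp
  have K_sum: "K (\<lambda>y. \<Sum>i\<in>I. f i y) T = (\<Sum>i\<in>I. K (f i) T)"
    if "T \<in> tensor s s" "\<And>i. module_hom s s (f i)" "finite I" for f :: "nat \<Rightarrow> 'a \<Rightarrow> 'a" and I T
    using that(3)
  proof (induction I)
    case empty
    have "K (\<lambda>x. 0) T + K (\<lambda>x. 0) T = K (\<lambda>x. 0) T"
      using K_add[OF zero zero that(1)] by (simp only: add_0_left)
    then show ?case by (simp only: sum.empty add_cancel_left_left)
  next
    case (insert i I)
    then show ?case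
      using K_add[OF that(2)[of i] module_hom_sum[OF that(2), of "\<lambda>i. i" I] that(1)]
      by (simp only: sum.insert not_False_eq_True)
  qed
  have "(\<Sum>l\<le>n. K (\<lambda>z. \<Sum>i\<le>n - l. A (n - l - i) (X i) z) (C l y)) =
      (\<Sum>i\<le>n. \<Sum>l\<le>n - i. K (A (n - i - l) (X i)) (C l y))" for n y
  proof -
    have "(\<Sum>l\<le>n. K (\<lambda>z. \<Sum>i\<le>n - l. A (n - l - i) (X i) z) (C l y)) =
        (\<Sum>l\<le>n. \<Sum>i\<le>n - l. K (A (n - l - i) (X i)) (C l y))"
      by (intro sum.cong refl K_sum C_tensor A finite_atMost)
    also have "\<dots> = (\<Sum>i\<le>n. \<Sum>l\<le>n - i. K (A (n - l - i) (X i)) (C l y))"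
      by (rule triangle_sum_swap)
    also have "\<dots> = (\<Sum>i\<le>n. \<Sum>l\<le>n - i. K (A (n - i - l) (X i)) (C l y))"
      by (intro sum.cong refl) (simp add: add.commute)
    finally show ?thesis .
  qed
  then show ?thesis
    by (simp only: hext2_eq_hext hext_hext[OF K_hom])
qed

lemma htensor_map_hext2:
  assumes A: "\<And>r x. module_hom s s (A r x)"
  shows "htensor_map s s id (hext2 A X) (hext C Y) =
      hext2 (\<lambda>n x y. \<Sum>l\<le>n. TM id (A (n - l) x) (C l y)) X Y"
    and "htensor_map s s (hext2 A X) id (hext C Y) =
      hext2 (\<lambda>n x y. \<Sum>l\<le>n. TM (A (n - l) x) id (C l y)) X Y"
proof -
  have hom: "module_hom s s (\<lambda>y. \<Sum>i\<le>r. A (r - i) (X i) y)" for r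
    by (rule module_hom_sum) (rule A)
  show "htensor_map s s id (hext2 A X) (hext C Y) =
      hext2 (\<lambda>n x y. \<Sum>l\<le>n. TM id (A (n - l) x) (C l y)) X Y"
    unfolding hext2_eq_hext[of A] htensor_map_id_left[of s, OF hom hext_C_tensor]
    by (rule hext_bilinear_action[OF A linear_tensor_map]) (rule tensor_map_add_right[OF hom_id(1)])
  show "htensor_map s s (hext2 A X) id (hext C Y) =
      hext2 (\<lambda>n x y. \<Sum>l\<le>n. TM (A (n - l) x) id (C l y)) X Y"
    unfolding hext2_eq_hext[of A] htensor_map_id_right[of s, OF hom hext_C_tensor]
    by (rule hext_bilinear_action[where K = "\<lambda>f. TM f id", OF A linear_tensor_map])
      (rule tensor_map_add_left[OF _ _ hom_id(1)])
qed

text \<open>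
  Associativity and coassociativity involve only maps that are visibly linear over the power
  series ring, so it suffices to check them on constant series. In the compatibility conditions
  the multiplication enters through \<open>htensor_map\<close>, and it is more direct to recognise every term
  as the extension of a family of bilinear maps and to compare the families.
\<close>

theorem topfree_ASI_bialgebra_flow:
  assumes base: "ASI_bialgebra s (M 0) (C 0)"
  shows "topfree_ASI_bialgebra s (hext2 M) (hext C)"
proof -
  note base = base[unfolded ASI_bialgebra_def assoc_algebra_def coassoc_coalgebra_def Let_def]
  note bilin = bilin_hext2[of s s s M, OF bilin_M]
  have L_hom: "module_hom (hscale s) (hscale s) (hext2 M X)"
    and R_hom: "module_hom (hscale s) (hscale s) (\<lambda>X. hext2 M X Y)" for X Y
    using bilin by (simp_all add: bilin_def)
  have Z: "hext2 M (hext2 M (hconst x) (hconst y)) (hconst z) =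
    hext2 M (hconst x) (hext2 M (hconst y) (hconst z))"
    for x y z
  proof
    fix n
    have assoc: "M 0 (M 0 x y) z = M 0 x (M 0 y z)" for x y z using base by blast
    have "hext2 M (hconst x) (hconst y) = (\<lambda>n. M n x y)" for x y
      by (simp only: hext2_hconst_left[of s s s, OF bilin_M] hext_hconst[OF M_hom(1)])
    then show "hext2 M (hext2 M (hconst x) (hconst y)) (hconst z) n =
        hext2 M (hconst x) (hext2 M (hconst y) (hconst z)) n"
      using M_assoc[OF assoc, where n = n]
      by (simp only: hext2_hconst_left[of s s s, OF bilin_M] hext2_hconst_right[of s s s, OF
        bilin_M] hext_def)
  qed
  note comp = module_hom_compose[unfolded o_def]
  note eqI = module_hom_eq_on_hconst[OF _ _ module_axioms module_axioms]
  have assoc: "hext2 M (hext2 M X Y) Z = hext2 M X (hext2 M Y Z)" for X Y Z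
  proof (rule eqI[where X = Z, OF L_hom comp[OF L_hom L_hom]])
    fix z
    show "hext2 M (hext2 M X Y) (hconst z) = hext2 M X (hext2 M Y (hconst z))"
    proof (rule eqI[where X = Y, OF comp[OF L_hom R_hom] comp[OF R_hom L_hom]])
      fix y
      show "hext2 M (hext2 M X (hconst y)) (hconst z) = hext2 M X (hext2 M (hconst y) (hconst z))"
        by (rule eqI[where X = X, OF comp[OF R_hom R_hom] R_hom]) (rule Z)
    qed
  qed
  have C_hext: "module_hom (hscale s) (hscale fun_scale) (hext C)"
    by (rule module_hom_hext[OF C_hom])
  have coassoc: "htensor_left s (hext C) (hext C X) = htensor_right s (hext C) (hext C X)" for X
    unfolding htensor_left_def htensor_right_def hcoeff_hext[OF C_hom]
  proof (rule module_hom_eq_on_hconst[where X = X,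
        OF comp[OF C_hext module_hom_hext[OF linear_tensor_left]] comp[OF C_hext module_hom_hext[OF
          linear_tensor_right]]
          module_axioms tens3.module_axioms], rule)
    fix x n
    have "tensor_left s (C 0) (C 0 x) = tensor_right s (C 0) (C 0 x)" for x using base by blast
    then show "hext (\<lambda>r. tensor_left s (C r)) (hext C (hconst x)) n =
        hext (\<lambda>r. tensor_right s (C r)) (hext C (hconst x)) n"
      unfolding hext_hconst[OF C_hom] unfolding hext_def by (rule C_coassoc)
  qed
  have R: "(\<lambda>Z. hext2 M Z Y) = hext2 (\<lambda>r x y. M r y x) Y" for Y
    by (rule ext) (rule hext2_commute)
  have der: "hext C (hext2 M X Y) =
      htensor_map s s id (hext2 M X) (hext C Y) +
        htensor_map s s (\<lambda>Z. hext2 M Z Y) id (hext C X)" for X Y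
  proof -
    have "C 0 (M 0 x y) = TM id (M 0 x) (C 0 y) + TM (\<lambda>z. M 0 z y) id (C 0 x)" for x y
      using base by blast
    note * = C_M_derivation[OF this]
    have "(\<Sum>i\<le>n. C (n - i) (M i x y)) =
        (\<Sum>l\<le>n. TM id (M (n - l) x) (C l y)) + (\<Sum>l\<le>n. TM (\<lambda>z. M (n - l) z y) id (C l x))" for n x y
    proof -
      have "(\<Sum>i\<le>n. C (n - i) (M i x y)) = (\<Sum>i\<le>n. C i (M (n - i) x y))"
        by (rule sum.reindex_bij_witness[where i = "\<lambda>i. n - i" and j = "\<lambda>i. n - i"]) auto
      then show ?thesis by (simp only: *)
    qed
    then show ?thesis
      unfolding R htensor_map_hext2[OF M_hom(1)] htensor_map_hext2[OF M_hom(2)]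
        hext_hext2[OF C_hom] hext2_commute[of _ Y X] hext2_add[symmetric] by simp
  qed
  have antisym: "(htensor_map s s (hext2 M Y) id (hext C X) -
    htensor_map s s id (\<lambda>Z. hext2 M Z Y) (hext C X)) +
      htensor_flip (htensor_map s s (hext2 M X) id (hext C Y) -
        htensor_map s s id (\<lambda>Z. hext2 M Z X) (hext C Y)) = 0"
    for X Y
  proof -
    have flip: "htensor_flip (hext2 B X Y) = hext2 (\<lambda>n x y. tensor_flip (B n x y)) X Y"
      for B :: "nat \<Rightarrow> 'a \<Rightarrow> 'a \<Rightarrow> ('k, 'a, 'a) tens" and X Y
      by (rule ext) (simp only: htensor_flip_def hext2_def tensor_flip_sum)
    have "(TM (M 0 y) id (C 0 x) - TM id (\<lambda>z. M 0 z y) (C 0 x)) +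
        tensor_flip (TM (M 0 x) id (C 0 y) - TM id (\<lambda>z. M 0 z x) (C 0 y)) = 0" for x y
      using base by blast
    note * = C_M_antisymmetry[OF this]
    have "((\<Sum>l\<le>n. TM (M (n - l) y) id (C l x)) - (\<Sum>l\<le>n. TM id (\<lambda>z. M (n - l) z y) (C l x))) +
        tensor_flip ((\<Sum>l\<le>n. TM (M (n - l) x) id (C l y)) - (\<Sum>l\<le>n. TM id (\<lambda>z. M (n -
          l) z x) (C l y))) = 0"
      for n x y
      using *[of n y x] by (simp only: sum_subtractf sum.distrib tensor_flip_sum[symmetric])
    then show ?thesis
      unfolding R htensor_map_hext2[OF M_hom(1)] htensor_map_hext2[OF M_hom(2)]
        hext2_commute[of _ Y X] hext2_add[symmetric] hext2_diff[symmetric] flip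
      by (simp only: hext2_zero)
  qed
  show ?thesis
    unfolding topfree_ASI_bialgebra_def assoc_algebra_def topfree_coassoc_coalgebra_def Let_def
    using module_hscale[OF module_axioms] bilin assoc vector_space_axioms C_hext coassoc der antisym
      hext_C_tensor
    by (simp add: hseries_def)
qed

end

theorem theorem2p18:
  fixes s :: "'k::field_char_0 \<Rightarrow> 'a::ab_group_add \<Rightarrow> 'a"
    and m :: "'a \<Rightarrow> 'a \<Rightarrow> 'a"
    and D :: "'a \<Rightarrow> ('k, 'a, 'a) tens"
    and d1 d2 p1 p2 :: "'a \<Rightarrow> 'a"
  assumes "ASI_bialgebra s m D"
    and "coherent_derivation s m D d1 p1"
    and "coherent_derivation s m D d2 p2"
    and "d1 \<circ> d2 = d2 \<circ> d1"
    and "p1 \<circ> p2 = p2 \<circ> p1"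
    and "\<And>x y. m (d1 x) (d2 y) = p2 (m x (d1 y))"
    and "\<And>x y. m (d1 x) (d2 y) = p1 (m (d2 x) y)"
    and "\<And>x. tensor_map s s p1 p2 (D x) = tensor_map s s id p1 (D (d2 x))"
    and "\<And>x. tensor_map s s p1 p2 (D x) = tensor_map s s p2 id (D (d1 x))"
  shows "ASI_bialgebra_deformation s m D (induced_mult s m d1 d2) (induced_comult s D p1 p2)"
proof -
  note asi = assms(1)[unfolded ASI_bialgebra_def assoc_algebra_def coassoc_coalgebra_def]
  have "coherent_derivation s m D d p" if "(d, p) \<in> {(d1, p1), (d2, p2)}" for d p
    using that assms(2,3) by auto
  note coh = this[unfolded coherent_derivation_def derivation_def coderivation_def]
  have hom: "module_hom s s d1" "module_hom s s d2" "module_hom s s p1" "module_hom s s p2"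
    using coh[of d1 p1] coh[of d2 p2] by (auto simp: module_hom_iff_linear)
  interpret commuting_pairs s d1 d2 p1 p2
    using hom fun_cong[OF assms(4)] fun_cong[OF assms(5)]
      by (intro commuting_pairs.intro) (simp_all add: o_def)
  have D: "module_hom s fun_scale D" "D x \<in> tensor s s" for x
    using asi by (auto simp: module_hom_iff_linear)
  have m_coh: "coherent_mult m"
    unfolding coherent_mult_def
  proof (intro conjI allI impI)
    show "bilin s s s m" using asi by blast
    fix d p x y
    assume dp: "(d, p) \<in> {(d1, p1), (d2, p2)}"
    show "d (m x y) = m (d x) y + m x (d y)" "m (p x) y = m x (d y) + p (m x y)"
      "m x (p y) = m (d x) y + p (m x y)"
      using coh[OF dp] by blast+
  qed (fact assms(6,7))+
  have D_coh: "coherent_comult D"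
    unfolding coherent_comult_def
  proof (intro conjI allI impI)
    fix d p x
    assume dp: "(d, p) \<in> {(d1, p1), (d2, p2)}"
    show "D (p x) = TM p id (D x) + TM id p (D x)" "TM d id (D x) = TM id p (D x) + D (d x)"
      "TM id d (D x) = TM p id (D x) + D (d x)"
      using coh[OF dp] by blast+
  qed (fact D assms(8,9))+
  interpret coherent_flow s d1 d2 p1 p2
    "\<lambda>r x y. s (1 / fact r) (m ((d1 ^^ r) x) ((d2 ^^ r) y))"
    "\<lambda>r x. fun_scale (1 / fact r) (TM (p1 ^^ r) (p2 ^^ r) (D x))"
    by (rule coherent_flow_exponential[OF m_coh D_coh])
  let ?M = "\<lambda>r x y. s (1 / fact r) (m ((d1 ^^ r) x) ((d2 ^^ r) y))"
    and ?C = "\<lambda>r x. fun_scale (1 / fact r) (TM (p1 ^^ r) (p2 ^^ r) (D x))"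
  have M0: "?M 0 = m" by (simp add: fun_eq_iff)
  have C0: "?C 0 = D"
    using tensor_map_id[OF D(2)] by (intro ext) (simp add: id_def fun_scale_def)
  have "topfree_ASI_bialgebra s (induced_mult s m d1 d2) (induced_comult s D p1 p2)"
    unfolding induced_mult_def induced_comult_def
    using topfree_ASI_bialgebra_flow assms(1) by (simp only: M0 C0)
  moreover have "eq_mod_h s UNIV (induced_mult s m d1 d2 (hconst x) (hconst y)) (hconst (m x y))"
    for x y
  proof (rule eq_mod_hI[OF module_axioms])
    show "induced_mult s m d1 d2 (hconst x) (hconst y) 0 = hconst (m x y) 0"
      by (simp add: induced_mult_def hext2_def hconst_def)
  qed simp
  moreover have "eq_mod_h fun_scale (tensor s s) (induced_comult s D p1 p2 (hconst x)) (hconst (D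
    x))" for x
  proof (rule eq_mod_hI[OF tens.module_axioms])
    have *: "induced_comult s D p1 p2 (hconst x) = (\<lambda>n. ?C n x)"
      unfolding induced_comult_def by (rule hext_hconst[OF C_hom])
    show "induced_comult s D p1 p2 (hconst x) 0 = hconst (D x) 0"
      unfolding * using fun_cong[OF C0, of x] by (simp only: hconst_def if_True simp_thms)
    show "induced_comult s D p1 p2 (hconst x) (Suc n) - hconst (D x) (Suc n) \<in> tensor s s" for n
      unfolding * using C_tensor[of "Suc n" x]
        by (simp only: hconst_def nat.distinct if_False diff_zero)
  qed
  ultimately show ?thesis
    unfolding ASI_bialgebra_deformation_def by blast
qed

end
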